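(* Let $\mathbf r,\mathbf a\in\mathbb R^3$ with $|\mathbf a|>|\mathbf r|>0$, and put $\mathbf r'=\mathbf r+\mathbf a$, $r=|\mathbf r|$, $r'=|\mathbf r'|$, $a=|\mathbf a|$. Then for all integers $l\ge0$ and $|m|\le l$ the real vector spherical harmonic $W_{lm}$ satisfies $$r'^{-l}W_{lm}(\hat{\mathbf r}')=\sum_{\lambda=1}^{\infty}\sum_{\mu=-\lambda}^{\lambda}H_{l,\lambda}^{[m],\mu}(\mathbf a)\,(r^{\lambda+1}+a^2r^{\lambda-1})\,W_\lambda^\mu(\hat{\mathbf r})$$ $$+\sum_{\lambda=1}^{\infty}\sum_{\mu=-\lambda}^{\lambda}\sum_{q=-1}^{1}\sum_{m_1=-1}^{1}\sum_{\substack{|\lambda-2|\le k\le\lambda\\k\ne\lambda-1}}\ \sum_{|k-1|\le j\le k+1}2r^\lambda a_{-q}\,H_{l,\lambda}^{[m],\mu}(\mathbf a)\,K_{k,j,\lambda}^{m_1,\mu,q}\,\vec Y_{j,k,q+\mu}(\hat{\mathbf r})$$ $$+(2l+1)\sum_{\lambda=0}^\infty\sum_{\mu=-\lambda}^\lambda\frac{r^{\lambda+1}}{2\lambda+1}H_{l,\lambda}^{[m],\mu}(\mathbf a)\big(W_\lambda^\mu(\hat{\mathbf r})-V_\lambda^\mu(\hat{\mathbf r})\big)$$ $$+(2l+1)\sum_{\lambda=0}^\infty\sum_{\mu=-\lambda}^\lambda\sum_{q=-1}^1\ \sum_{|\lambda-1|\le j\le\lambda+1}(-1)^qa_{-q}r^\lambda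 H_{l,\lambda}^{[m],\mu}(\mathbf a)\,\langle\lambda,\mu;1,q\mid j,\mu+q\rangle\,\vec Y_{j,\lambda,q+\mu}(\hat{\mathbf r}),$$ where $V_\lambda^\mu$, $W_\lambda^\mu$ and $\vec Y_{j,k,\nu}$ are expressed through the real vector spherical harmonics by: for each $Z\in\{V,W,X\}$, $$Z_\lambda^\mu=\begin{cases}\frac{(-1)^\mu}{\sqrt2}(Z_{\lambda\mu}+iZ_{\lambda,-\mu}),&\mu>0,\\ Z_{\lambda0},&\mu=0,\\ \frac1{\sqrt2}(Z_{\lambda,-\mu}-iZ_{\lambda\mu}),&\mu<0,\end{cases}$$ $$\vec Y_{k-1,k,\nu}=\frac{V_{k-1}^{\nu}}{\sqrt{k(2k-1)}},\qquad \vec Y_{k,k,\nu}=\frac{-i\,X_k^\nu}{\sqrt{k(k+1)}},\qquad \vec Y_{k+1,k,\nu}=\frac{W_{k+1}^\nu}{\sqrt{(k+1)(2k+3)}}.$$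
   Context: For nonzero $\mathbf r$, $\hat{\mathbf r}=\mathbf r/|\mathbf r|$. $Y_l^m$ are the standard $L^2$-orthonormal complex spherical harmonics on the unit sphere with Condon–Shortley phase. Real spherical harmonics: $Y_{lm}=\frac1{\sqrt2}(Y_l^{-m}+(-1)^mY_l^m)$ for $m>0$, $Y_{l0}=Y_l^0$, $Y_{lm}=\frac{i}{\sqrt2}(Y_l^m-(-1)^mY_l^{-m})$ for $m<0$. With $\nabla_S$ the surface gradient on the unit sphere: $V_{lm}=\nabla_SY_{lm}-(l+1)Y_{lm}\hat{\mathbf r}$, $W_{lm}=\nabla_SY_{lm}+lY_{lm}\hat{\mathbf r}$, $X_{lm}=\hat{\mathbf r}\times\nabla_SY_{lm}$; $V_l^m,W_l^m,X_l^m$ are given by the same formulas with $Y_l^m$. Irregular solid harmonics: $I_l^m(\mathbf r)=\sqrt{\frac{4\pi}{2l+1}}\,Y_l^m(\hat{\mathbf r})|\mathbf r|^{-l-1}$. For $\lambda\ge0$, $|\mu|\le\lambda$, $$H_{l,\lambda}^{m,\mu}(\mathbf a)=(-1)^{\lambda+\mu}\sqrt{\tfrac{2l+1}{2\lambda+1}}\,I_{l+\lambda}^{m-\mu}(\mathbf a)\sqrt{\tbinom{l+\lambda+\mu-m}{\lambda+\mu}\tbinom{l+\lambda+m-\mu}{\lambda-\mu}},$$ and $H_{l,\lambda}^{[m],\mu}=\frac1{\sqrt2}(H_{l,\lambda}^{-m,\mu}+(-1)^mH_{l,\lambda}^{m,\mu})$ for $m>0$, $H_{l,\lambda}^{[0],\mu}=H_{l,\lambda}^{0,\mu}$,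 $H_{l,\lambda}^{[m],\mu}=\frac{i}{\sqrt2}(H_{l,\lambda}^{m,\mu}-(-1)^mH_{l,\lambda}^{-m,\mu})$ for $m<0$. $\langle j_1,m_1;j_2,m_2\mid j,m\rangle$ are the standard (Condon–Shortley) Clebsch–Gordan coefficients, equal to $0$ for inadmissible indices (in particular, for $k=0$ or $\lambda=0$ only $j=1$ contributes). For $\mathbf a=(a_x,a_y,a_z)$, $a_{-q}=\frac1{\sqrt2}(a_x-ia_y)$ if $q=1$, $a_z$ if $q=0$, $-\frac1{\sqrt2}(a_x+ia_y)$ if $q=-1$. Finally $$K_{k,j,\lambda}^{m_1,\mu,q}=\sqrt{\tfrac{\lambda(2\lambda+1)(2\lambda-1)}{2k+1}}(-1)^q\langle\lambda-1,\mu-m_1;1,m_1\mid\lambda,\mu\rangle\langle1,q;\lambda-1,\mu-m_1\mid k,q+\mu-m_1\rangle\langle1,0;\lambda-1,0\mid k,0\rangle\langle k,q+\mu-m_1;1,m_1\mid j,q+\mu\rangle.$$ Terms with $|q+\mu|>j$ have vanishing coefficient and are understood to be zero. Infinite sums over $\lambda$ are limits of partial sums (inner sums are finite). *)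

theory Defs
  imports "HOL-Analysis.Analysis" "HOL-Computational_Algebra.Polynomial"
begin

section \<open>Scalar spherical harmonics\<close>

text \<open>Rodrigues' formula.\<close>

definition legendre_poly :: "nat \<Rightarrow> real poly" where
  "legendre_poly l = smult (1 / (2 ^ l * fact l)) ((pderiv ^^ l) ([:-1, 0, 1:] ^ l))"

text \<open>The factor \<open>(-1) ^ m\<close> is the Condon--Shortley phase.\<close>

definition assoc_legendre :: "nat \<Rightarrow> nat \<Rightarrow> real \<Rightarrow> real" where
  "assoc_legendre l m x =
     (-1) ^ m * sqrt (1 - x\<^sup>2) ^ m * poly ((pderiv ^^ m) (legendre_poly l)) x"

text \<open>
  Colatitude \<open>\<theta>\<close>, longitude \<open>\<phi>\<close>. Negative orders are reduced to positive ones by the usual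
  symmetry. Orders with \<open>\<bar>m\<bar> > l\<close> give \<open>0\<close>, the derivative of the Legendre polynomial being zero.
\<close>

definition sph_harm_angles :: "nat \<Rightarrow> int \<Rightarrow> real \<Rightarrow> real \<Rightarrow> complex" where
  "sph_harm_angles l m \<theta> \<phi> =
     (let k = nat \<bar>m\<bar>;
          y = complex_of_real (sqrt ((2 * real l + 1) / (4 * pi) * (fact (l - k) / fact (l + k)))
                * assoc_legendre l k (cos \<theta>)) * cis (real k * \<phi>)
      in if m \<ge> 0 then y else (-1) ^ k * cnj y)"

text \<open>
  \<open>Y\<^sub>l\<^sup>m\<close> at a point of the unit sphere. At the poles the longitude is irrelevant, as only order
  \<open>0\<close> does not vanish there.
\<close>

definition sph_harm :: "nat \<Rightarrow> int \<Rightarrow> real ^ 3 \<Rightarrow> complex" where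
  "sph_harm l m u = sph_harm_angles l m (arccos (u $ 3)) (Arg (Complex (u $ 1) (u $ 2)))"

text \<open>
  The passage from a complex family indexed by orders to its real counterpart, used both for
  \<open>Y\<^sub>l\<^sub>m\<close> and for \<open>H\<close> with bracketed order.
\<close>

definition real_order :: "(int \<Rightarrow> complex) \<Rightarrow> int \<Rightarrow> complex" where
  "real_order f m =
     (if m > 0 then (f (- m) + (-1) powi m * f m) / sqrt 2
      else if m = 0 then f 0
      else \<i> / sqrt 2 * (f m - (-1) powi m * f (- m)))"

text \<open>The real spherical harmonics, kept complex-valued so that \<open>Y\<^sub>l\<^sub>m\<close> and \<open>Y\<^sub>l\<^sup>m\<close> share a type.\<close>

definition real_sph_harm :: "nat \<Rightarrow> int \<Rightarrow> real ^ 3 \<Rightarrow> complex" where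
  "real_sph_harm l m u = real_order (\<lambda>m'. sph_harm l m' u) m"


section \<open>Vector spherical harmonics\<close>

definition cvec :: "real ^ 3 \<Rightarrow> complex ^ 3" where
  "cvec u = (\<chi> i. complex_of_real (u $ i))"

text \<open>The library's cross product is restricted to real vectors.\<close>

definition ccross :: "complex ^ 3 \<Rightarrow> complex ^ 3 \<Rightarrow> complex ^ 3" where
  "ccross v w = vector [v $ 2 * w $ 3 - v $ 3 * w $ 2,
                        v $ 3 * w $ 1 - v $ 1 * w $ 3,
                        v $ 1 * w $ 2 - v $ 2 * w $ 1]"

text \<open>
  The surface gradient at a point \<open>u\<close> of the unit sphere is the Euclidean gradient of the extension
  of \<open>f\<close> that is constant along rays; note \<open>sgn x = x /\<^sub>R norm x\<close>.
\<close>

definition surf_grad :: "(real ^ 3 \<Rightarrow> complex) \<Rightarrow> real ^ 3 \<Rightarrow> complex ^ 3" where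
  "surf_grad f u = (\<chi> i. frechet_derivative (\<lambda>x. f (sgn x)) (at u) (axis i 1))"

text \<open>
  These act on a scalar function, so that \<open>V\<^sub>l\<^sup>m\<close> is \<open>vsh_V l (sph_harm l m)\<close> and \<open>V\<^sub>l\<^sub>m\<close> is
  \<open>vsh_V l (real_sph_harm l m)\<close>, and likewise for \<open>W\<close> and \<open>X\<close>. The degree in \<open>vsh_X\<close> is
  unused; it gives the three operators a common type.
\<close>

definition vsh_V :: "nat \<Rightarrow> (real ^ 3 \<Rightarrow> complex) \<Rightarrow> real ^ 3 \<Rightarrow> complex ^ 3" where
  "vsh_V l f u = surf_grad f u - ((of_nat l + 1) * f u) *s cvec u"

definition vsh_W :: "nat \<Rightarrow> (real ^ 3 \<Rightarrow> complex) \<Rightarrow> real ^ 3 \<Rightarrow> complex ^ 3" where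
  "vsh_W l f u = surf_grad f u + (of_nat l * f u) *s cvec u"

definition vsh_X :: "nat \<Rightarrow> (real ^ 3 \<Rightarrow> complex) \<Rightarrow> real ^ 3 \<Rightarrow> complex ^ 3" where
  "vsh_X l f u = ccross (cvec u) (surf_grad f u)"

text \<open>\<open>\<Y>\<close> with indices \<open>j, k, \<nu>\<close>; only \<open>j \<in> {k - 1, k, k + 1}\<close> is meaningful.\<close>

definition vsh_Y :: "nat \<Rightarrow> nat \<Rightarrow> int \<Rightarrow> real ^ 3 \<Rightarrow> complex ^ 3" where
  "vsh_Y j k \<nu> u =
     (if j + 1 = k then
        complex_of_real (1 / sqrt (real k * (2 * real k - 1))) *s vsh_V j (sph_harm j \<nu>) u
      else if j = k then
        (- \<i> / complex_of_real (sqrt (real k * (real k + 1)))) *s vsh_X k (sph_harm k \<nu>) u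
      else if j = k + 1 then
        complex_of_real (1 / sqrt ((real k + 1) * (2 * real k + 3))) *s vsh_W j (sph_harm j \<nu>) u
      else 0)"


section \<open>Coefficients\<close>

definition irreg_solid :: "nat \<Rightarrow> int \<Rightarrow> real ^ 3 \<Rightarrow> complex" where
  "irreg_solid l m r =
     complex_of_real (sqrt (4 * pi / (2 * real l + 1)) / norm r ^ (l + 1)) * sph_harm l m (sgn r)"

definition H_coeff :: "nat \<Rightarrow> nat \<Rightarrow> int \<Rightarrow> int \<Rightarrow> real ^ 3 \<Rightarrow> complex" where
  "H_coeff l n m \<mu> a =
     (-1) powi (int n + \<mu>)
     * complex_of_real (sqrt ((2 * real l + 1) / (2 * real n + 1)))
     * irreg_solid (l + n) (m - \<mu>) a
     * complex_of_real (sqrt (real (nat (int l + int n + \<mu> - m) choose nat (int n + \<mu>))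
                            * real (nat (int l + int n + m - \<mu>) choose nat (int n - \<mu>))))"

definition H_coeff_real :: "nat \<Rightarrow> nat \<Rightarrow> int \<Rightarrow> int \<Rightarrow> real ^ 3 \<Rightarrow> complex" where
  "H_coeff_real l n m \<mu> a = real_order (\<lambda>m'. H_coeff l n m' \<mu> a) m"

text \<open>
  Racah's formula for the Clebsch--Gordan coefficient
  \<open>\<langle>j1, m1; j2, m2 | j, m\<rangle>\<close> with integer angular momenta. The sum runs over all \<open>s\<close> for which
  every factorial has a nonnegative argument.
\<close>

definition clebsch_gordan :: "int \<Rightarrow> int \<Rightarrow> int \<Rightarrow> int \<Rightarrow> int \<Rightarrow> int \<Rightarrow> real" where
  "clebsch_gordan j1 m1 j2 m2 j m =
     (let fac = (\<lambda>i::int. fact (nat i) :: real) in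
      if \<bar>m1\<bar> \<le> j1 \<and> \<bar>m2\<bar> \<le> j2 \<and> \<bar>m\<bar> \<le> j \<and> m = m1 + m2 \<and> \<bar>j1 - j2\<bar> \<le> j \<and> j \<le> j1 + j2
      then
        sqrt (of_int (2 * j + 1) * fac (j + j1 - j2) * fac (j - j1 + j2) * fac (j1 + j2 - j)
              / fac (j1 + j2 + j + 1))
        * sqrt (fac (j + m) * fac (j - m) * fac (j1 - m1) * fac (j1 + m1)
                * fac (j2 - m2) * fac (j2 + m2))
        * (\<Sum>s | 0 \<le> s \<and> s \<le> j1 + j2 - j \<and> s \<le> j1 - m1 \<and> s \<le> j2 + m2
                  \<and> 0 \<le> j - j2 + m1 + s \<and> 0 \<le> j - j1 - m2 + s.
             (-1) powi s / (fac s * fac (j1 + j2 - j - s) * fac (j1 - m1 - s) * fac (j2 + m2 - s)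
                            * fac (j - j2 + m1 + s) * fac (j - j1 - m2 + s)))
      else 0)"

text \<open>\<open>sph_comp a p\<close> is \<open>a\<^sub>p\<close>, so the components \<open>a\<^sub>-\<^sub>q\<close> occurring below are \<open>sph_comp a (- q)\<close>.\<close>

definition sph_comp :: "real ^ 3 \<Rightarrow> int \<Rightarrow> complex" where
  "sph_comp a p =
     (if p = -1 then Complex (a $ 1) (- (a $ 2)) / sqrt 2
      else if p = 0 then complex_of_real (a $ 3)
      else if p = 1 then - (Complex (a $ 1) (a $ 2) / sqrt 2)
      else 0)"

definition K_coeff :: "nat \<Rightarrow> nat \<Rightarrow> nat \<Rightarrow> int \<Rightarrow> int \<Rightarrow> int \<Rightarrow> real" where
  "K_coeff k j n m1 \<mu> q =
     sqrt (real n * (2 * real n + 1) * (2 * real n - 1) / (2 * real k + 1))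
     * (-1) powi q
     * clebsch_gordan (int n - 1) (\<mu> - m1) 1 m1 (int n) \<mu>
     * clebsch_gordan 1 q (int n - 1) (\<mu> - m1) (int k) (q + \<mu> - m1)
     * clebsch_gordan 1 0 (int n - 1) 0 (int k) 0
     * clebsch_gordan (int k) (q + \<mu> - m1) 1 m1 (int j) (q + \<mu>)"

end

theory Submission
  imports Defs "HOL-Complex_Analysis.Cauchy_Integral_Formula"
begin

text \<open>
  Write \<open>\<Phi> x = Y (x / |x|) / |x| ^ (l + 1)\<close> for the decaying harmonic function with boundary values
  \<open>Y = Y\<^sub>l\<^sub>m\<close>. Its gradient is \<open>V / |x| ^ (l + 2)\<close>, and \<open>W = V + (2 l + 1) Y x / |x|\<close>, so the left-hand
  side of the theorem is \<open>|r'|\<^sup>2 \<nabla>\<Phi> r' + (2 l + 1) \<Phi> r' r'\<close> at \<open>r' = r + a\<close>. Expanding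
  \<open>|r'|\<^sup>2 = (|r|\<^sup>2 + |a|\<^sup>2) + 2 (a \<bullet> r)\<close> and \<open>r' = r + a\<close> splits this into four parts, and each of the
  four series is one of them: the coefficients \<open>H\<close> are those of the expansion of \<open>\<Phi> (r + a)\<close> in regular
  solid harmonics of \<open>r\<close>, and \<open>|r| ^ (n - 1) W\<^sub>n\<close> is the gradient of the solid harmonic of degree \<open>n\<close>.
  The identities hold separately in each degree \<open>n\<close>. Two things remain: the convergence of the
  expansion and of its gradient to the right limits, and the rewriting of the products with the
  scalar \<open>a \<bullet> r\<close> and with the vector \<open>a\<close> in terms of Clebsch--Gordan coefficients.

  For the expansion, everything is expressed in the coordinates \<open>z\<close>, \<open>v = - (x + i y) / 2\<close> and
  \<open>w = (x - i y) / 2\<close>. With a suitable normalisation, \<open>\<partial>\<^sub>z\<close>, \<open>\<partial>\<^sub>v\<close> and \<open>\<partial>\<^sub>w\<close> send, up to sign,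
  an irregular solid harmonic of degree \<open>l\<close> and order \<open>m\<close> to one of degree \<open>l + 1\<close> and order \<open>m\<close>, \<open>m - 1\<close>, \<open>m + 1\<close>
  (\<open>has_field_derivative_irreg\<close>). The derivatives along \<open>t \<mapsto> a + t r\<close> are therefore sums over powers
  of these three shifts, and the coefficients are exactly the regular solid harmonics of \<open>r\<close>. The
  squared length of \<open>a + t r\<close> is a quadratic polynomial in \<open>t\<close> which avoids the branch cut of the square
  root for complex \<open>|t| < |a| / |r|\<close>; hence the function along the line is holomorphic in that disc
  and its Taylor series converges at \<open>t = 1\<close> (\<open>irreg_addition\<close>). No limit is interchanged
  with a derivative: the gradient of an irregular harmonic consists of irregular harmonics of degree
  \<open>l + 1\<close>, and the differentiated series are their addition theorems
  (\<open>potential_grad_addition\<close>). These expansions are proved for the complex harmonics; the real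
  ones, and the coefficients with bracketed order, are the same linear combinations of them.

  For the products, Racah's sum collapses when one of the spins is \<open>1\<close>, which gives the table
  \<open>cg_up\<close>, \<open>cg_same\<close>, \<open>cg_down\<close>. Together with explicit components of \<open>V\<close>, \<open>W\<close>, \<open>X\<close> in the spherical
  basis it yields the three coupling rules \<open>sph_harm_smult_basis\<close> (for \<open>Y e\<^sub>q\<close>),
  \<open>vsh_W_coupling\<close> (for \<open>W\<close>) and \<open>sph_comp_mult_sph_harm\<close> (for a coordinate times \<open>Y\<close>), whose composition
  is the coefficient \<open>K\<close>.
\<close>

section \<open>Regular solid harmonics\<close>

text \<open>
  The coefficient of \<open>u\<^sup>\<mu>\<close> in \<open>(z + v u + w / u) ^ n / n!\<close>. For \<open>v = - (x + i y) / 2\<close> and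
  \<open>w = (x - i y) / 2\<close> it is the regular solid harmonic \<open>r\<^sup>n P\<^sub>n\<^sup>\<mu> (cos \<theta>) e\<^sup>i\<^sup>\<mu>\<^sup>\<phi> / (n + \<mu>)!\<close>. This normalisation
  makes the partial derivatives pure index shifts, and the recursion is then Euler's identity for a
  homogeneous function of degree \<open>n\<close>. The three arguments are independent complex numbers so that a
  line in space can be followed to complex parameters.
\<close>
fun solid :: "nat \<Rightarrow> int \<Rightarrow> complex \<Rightarrow> complex \<Rightarrow> complex \<Rightarrow> complex" where
  "solid 0 \<mu> z v w = (if \<mu> = 0 then 1 else 0)"
| "solid (Suc n) \<mu> z v w =
     (z * solid n \<mu> z v w + v * solid n (\<mu> - 1) z v w + w * solid n (\<mu> + 1) z v w) / of_nat (Suc n)"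

text \<open>The degree below, with \<open>0\<close> below degree \<open>0\<close>: the three partial derivatives have this form.\<close>
definition solid_pred :: "nat \<Rightarrow> int \<Rightarrow> complex \<Rightarrow> complex \<Rightarrow> complex \<Rightarrow> complex" where
  "solid_pred n \<mu> z v w = (if n = 0 then 0 else solid (n - 1) \<mu> z v w)"

lemma solid_pred_simps [simp]:
  "solid_pred 0 \<mu> z v w = 0"
  "solid_pred (Suc n) \<mu> z v w = solid n \<mu> z v w"
  by (simp_all add: solid_pred_def)

lemma solid_eq_0: "\<bar>\<mu>\<bar> > int n \<Longrightarrow> solid n \<mu> z v w = 0"
  by (induction n arbitrary: \<mu>) auto

lemma solid_euler:
  "of_nat n * solid n \<mu> z v w =
     z * solid_pred n \<mu> z v w + v * solid_pred n (\<mu> - 1) z v w + w * solid_pred n (\<mu> + 1) z v w"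
  by (cases n) (simp_all del: of_nat_Suc)

text \<open>
  The substitution \<open>(v, w) \<mapsto> (c v, w / c)\<close> multiplies the harmonic of order \<open>\<mu>\<close> by \<open>c\<^sup>\<mu>\<close>; this is the
  derivative of that homogeneity at \<open>c = 1\<close>, that is, the eigenvalue equation of \<open>L\<^sub>z\<close>.
\<close>
lemma solid_weight:
  "of_int \<mu> * solid n \<mu> z v w = v * solid_pred n (\<mu> - 1) z v w - w * solid_pred n (\<mu> + 1) z v w"
proof (induction n arbitrary: \<mu>)
  case 0
  show ?case by simp
next
  case (Suc n)
  define S where "S = (\<lambda>\<mu>. solid n \<mu> z v w)"
  define P where "P = (\<lambda>\<mu>. solid_pred n \<mu> z v w)"
  have IH: "of_int \<nu> * S \<nu> = v * P (\<nu> - 1) - w * P (\<nu> + 1)" for \<nu>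
    using Suc.IH by (simp add: S_def P_def)
  have eu: "of_nat n * S \<nu> = z * P \<nu> + v * P (\<nu> - 1) + w * P (\<nu> + 1)" for \<nu>
    using solid_euler by (simp add: S_def P_def)
  have i: "of_int \<mu> * S \<mu> = v * P (\<mu> - 1) - w * P (\<mu> + 1)"
          "(of_int \<mu> - 1) * S (\<mu> - 1) = v * P (\<mu> - 2) - w * P \<mu>"
          "(of_int \<mu> + 1) * S (\<mu> + 1) = v * P \<mu> - w * P (\<mu> + 2)"
    using IH[of \<mu>] IH[of "\<mu> - 1"] IH[of "\<mu> + 1"] by (simp_all add: algebra_simps)
  have e: "of_nat n * S (\<mu> - 1) = z * P (\<mu> - 1) + v * P (\<mu> - 2) + w * P \<mu>"
          "of_nat n * S (\<mu> + 1) = z * P (\<mu> + 1) + v * P \<mu> + w * P (\<mu> + 2)"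
    using eu[of "\<mu> - 1"] eu[of "\<mu> + 1"] by (simp_all add: algebra_simps)
  have "of_int \<mu> * (z * S \<mu> + v * S (\<mu> - 1) + w * S (\<mu> + 1))
      = (1 + of_nat n) * (v * S (\<mu> - 1) - w * S (\<mu> + 1))"
    using i e by algebra
  moreover have "(1 + of_nat n :: complex) \<noteq> 0"
    by (metis of_nat_Suc of_nat_neq_0)
  ultimately show ?case
    by (simp add: S_def field_simps)
qed

lemma solid_raise:
  "(of_nat n + of_int \<mu>) * solid n \<mu> z v w
     = z * solid_pred n \<mu> z v w + 2 * v * solid_pred n (\<mu> - 1) z v w"
  using solid_euler[of n \<mu> z v w] solid_weight[of \<mu> n z v w] by (simp add: algebra_simps)

lemma solid_lower:
  "(of_nat n - of_int \<mu>) * solid n \<mu> z v w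
     = z * solid_pred n \<mu> z v w + 2 * w * solid_pred n (\<mu> + 1) z v w"
  using solid_euler[of n \<mu> z v w] solid_weight[of \<mu> n z v w] by (simp add: algebra_simps)

text \<open>
  Applying a raising and a lowering relation one after the other eliminates the neighbouring order.
  The quadratic form \<open>z\<^sup>2 - 4 v w\<close> is the squared length. The right-hand sides of this and the next
  two lemmas are the numerators that appear when \<open>solid n \<mu> / |x| ^ (2 n + 1)\<close> is differentiated in
  \<open>z\<close>, \<open>v\<close> and \<open>w\<close>.
\<close>
lemma solid_three_term:
  "(of_nat n + 1 - of_int \<mu>) * (of_nat n + 1 + of_int \<mu>) * solid (Suc n) \<mu> z v w
     = (2 * of_nat n + 1) * z * solid n \<mu> z v w - (z\<^sup>2 - 4 * v * w) * solid_pred n \<mu> z v w"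
  using solid_raise[of "Suc n" \<mu> z v w] solid_lower[of n "\<mu> - 1" z v w] solid_raise[of n \<mu> z v w]
  by (simp del: solid.simps, algebra)

lemma solid_three_term_minus:
  "(of_nat n - of_int \<mu> + 2) * (of_nat n - of_int \<mu> + 1) * solid (Suc n) (\<mu> - 1) z v w
     = (z\<^sup>2 - 4 * v * w) * solid_pred n (\<mu> - 1) z v w + 2 * (2 * of_nat n + 1) * w * solid n \<mu> z v w"
  using solid_lower[of "Suc n" "\<mu> - 1" z v w] solid_lower[of n "\<mu> - 1" z v w]
    solid_raise[of n \<mu> z v w]
  by (simp del: solid.simps, algebra)

lemma solid_three_term_plus:
  "(of_nat n + of_int \<mu> + 2) * (of_nat n + of_int \<mu> + 1) * solid (Suc n) (\<mu> + 1) z v w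
     = (z\<^sup>2 - 4 * v * w) * solid_pred n (\<mu> + 1) z v w + 2 * (2 * of_nat n + 1) * v * solid n \<mu> z v w"
  using solid_raise[of "Suc n" "\<mu> + 1" z v w] solid_raise[of n "\<mu> + 1" z v w]
    solid_lower[of n \<mu> z v w]
  by (simp del: solid.simps, algebra)

lemma solid_homogeneous: "solid n \<mu> (c * z) (c * v) (c * w) = c ^ n * solid n \<mu> z v w"
  by (induction n arbitrary: \<mu>) (simp_all add: field_simps del: of_nat_Suc)

lemma solid_reflect: "solid n (- \<mu>) z v w = solid n \<mu> z w v"
proof (induction n arbitrary: \<mu>)
  case (Suc n)
  have "solid n (- \<mu> - 1) z v w = solid n (\<mu> + 1) z w v" "solid n (- \<mu> + 1) z v w = solid n (\<mu> - 1) z w v"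
    by (metis Suc diff_minus_eq_add minus_add_distrib minus_diff_eq uminus_add_conv_diff add.commute)+
  with Suc[of \<mu>] show ?case by (simp add: algebra_simps)
qed simp

lemma solid_rotate: "solid n \<mu> z (- v) (- w) = (-1) powi \<mu> * solid n \<mu> z v w"
  by (induction n arbitrary: \<mu>)
     (simp_all add: power_int_add power_int_diff field_simps del: of_nat_Suc)

lemma cnj_solid: "cnj (solid n \<mu> z v w) = solid n \<mu> (cnj z) (cnj v) (cnj w)"
  by (induction n arbitrary: \<mu>) simp_all

text \<open>
  In the derivative of the recursion, the terms in which a degree \<open>n\<close> harmonic is differentiated
  add up to \<open>n\<close> times the claim by Euler's identity, and the explicit arguments supply the last copy.
\<close>
lemma has_derivative_solid:
  fixes z v w :: "'a :: real_normed_vector \<Rightarrow> complex"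
  assumes "(z has_derivative z') (at x)" "(v has_derivative v') (at x)" "(w has_derivative w') (at x)"
  shows "((\<lambda>x. solid n \<mu> (z x) (v x) (w x)) has_derivative
     (\<lambda>h. solid_pred n \<mu> (z x) (v x) (w x) * z' h + solid_pred n (\<mu> - 1) (z x) (v x) (w x) * v' h
        + solid_pred n (\<mu> + 1) (z x) (v x) (w x) * w' h)) (at x)"
proof (induction n arbitrary: \<mu>)
  case 0
  show ?case by simp
next
  case (Suc n)
  define S where "S = (\<lambda>\<mu>. solid n \<mu> (z x) (v x) (w x))"
  define P where "P = (\<lambda>\<mu>. solid_pred n \<mu> (z x) (v x) (w x))"
  have IH: "((\<lambda>x. solid n \<nu> (z x) (v x) (w x)) has_derivative
     (\<lambda>h. P \<nu> * z' h + P (\<nu> - 1) * v' h + P (\<nu> + 1) * w' h)) (at x)" for \<nu>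
    unfolding P_def by (rule Suc.IH)
  have eu: "of_nat n * S \<nu> = z x * P \<nu> + v x * P (\<nu> - 1) + w x * P (\<nu> + 1)" for \<nu>
    using solid_euler by (simp add: S_def P_def)
  have e: "of_nat n * S \<mu> = z x * P \<mu> + v x * P (\<mu> - 1) + w x * P (\<mu> + 1)"
          "of_nat n * S (\<mu> - 1) = z x * P (\<mu> - 1) + v x * P (\<mu> - 2) + w x * P \<mu>"
          "of_nat n * S (\<mu> + 1) = z x * P (\<mu> + 1) + v x * P \<mu> + w x * P (\<mu> + 2)"
    using eu[of \<mu>] eu[of "\<mu> - 1"] eu[of "\<mu> + 1"] by (simp_all add: algebra_simps)
  have ne: "(1 + of_nat n :: complex) \<noteq> 0"
    by (metis of_nat_Suc of_nat_neq_0)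
  have "((\<lambda>x. (z x * solid n \<mu> (z x) (v x) (w x) + v x * solid n (\<mu> - 1) (z x) (v x) (w x)
            + w x * solid n (\<mu> + 1) (z x) (v x) (w x)) / of_nat (Suc n)) has_derivative
     (\<lambda>h. ((z x * (P \<mu> * z' h + P (\<mu> - 1) * v' h + P (\<mu> + 1) * w' h) + z' h * S \<mu>)
        + (v x * (P (\<mu> - 1) * z' h + P (\<mu> - 1 - 1) * v' h + P (\<mu> - 1 + 1) * w' h) + v' h * S (\<mu> - 1))
        + (w x * (P (\<mu> + 1) * z' h + P (\<mu> + 1 - 1) * v' h + P (\<mu> + 1 + 1) * w' h) + w' h * S (\<mu> + 1)))
          / of_nat (Suc n))) (at x)"
    unfolding S_def
    by (rule bounded_linear.has_derivative[OF bounded_linear_divide],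
        intro has_derivative_add has_derivative_mult assms IH)
  moreover have "(\<lambda>h. ((z x * (P \<mu> * z' h + P (\<mu> - 1) * v' h + P (\<mu> + 1) * w' h) + z' h * S \<mu>)
        + (v x * (P (\<mu> - 1) * z' h + P (\<mu> - 1 - 1) * v' h + P (\<mu> - 1 + 1) * w' h) + v' h * S (\<mu> - 1))
        + (w x * (P (\<mu> + 1) * z' h + P (\<mu> + 1 - 1) * v' h + P (\<mu> + 1 + 1) * w' h) + w' h * S (\<mu> + 1)))
          / of_nat (Suc n)) = (\<lambda>h. S \<mu> * z' h + S (\<mu> - 1) * v' h + S (\<mu> + 1) * w' h)" (is "?L = ?R")
  proof
    fix h
    have "((z x * (P \<mu> * z' h + P (\<mu> - 1) * v' h + P (\<mu> + 1) * w' h) + z' h * S \<mu>)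
        + (v x * (P (\<mu> - 1) * z' h + P (\<mu> - 2) * v' h + P \<mu> * w' h) + v' h * S (\<mu> - 1))
        + (w x * (P (\<mu> + 1) * z' h + P \<mu> * v' h + P (\<mu> + 2) * w' h) + w' h * S (\<mu> + 1)))
      = (1 + of_nat n) * (S \<mu> * z' h + S (\<mu> - 1) * v' h + S (\<mu> + 1) * w' h)"
      using e by algebra
    with ne show "?L h = ?R h" by (simp add: field_simps)
  qed
  ultimately show ?case by (simp add: S_def)
qed

section \<open>Irregular solid harmonics along a line\<close>

text \<open>
  The square of the factor between \<open>solid\<close> and the Schmidt-normalised solid harmonic.
\<close>
definition solid_norm2 :: "nat \<Rightarrow> int \<Rightarrow> real" where
  "solid_norm2 n \<mu> = fact (nat (int n - \<mu>)) * fact (nat (int n + \<mu>))"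

lemma solid_norm2_pos [simp]: "solid_norm2 n \<mu> > 0" "solid_norm2 n \<mu> \<noteq> 0" "solid_norm2 n \<mu> \<ge> 0"
  by (simp_all add: solid_norm2_def)

lemma fact_nat_Suc: "x \<ge> 0 \<Longrightarrow> (fact (nat (x + 1)) :: real) = (of_int x + 1) * fact (nat x)"
  by (simp add: nat_add_distrib)

lemma solid_norm2_Suc:
  assumes "\<bar>\<mu>\<bar> \<le> int n"
  shows "solid_norm2 (Suc n) \<mu> = (real n + 1 - \<mu>) * (real n + 1 + \<mu>) * solid_norm2 n \<mu>"
    and "solid_norm2 (Suc n) (\<mu> - 1) = (real n - \<mu> + 2) * (real n - \<mu> + 1) * solid_norm2 n \<mu>"
    and "solid_norm2 (Suc n) (\<mu> + 1) = (real n + \<mu> + 2) * (real n + \<mu> + 1) * solid_norm2 n \<mu>"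
proof -
  have p: "int n - \<mu> \<ge> 0" "int n + \<mu> \<ge> 0" using assms by auto
  have f: "(fact (nat (int n - \<mu> + 1)) :: real) = (real n - \<mu> + 1) * fact (nat (int n - \<mu>))"
          "(fact (nat (int n + \<mu> + 1)) :: real) = (real n + \<mu> + 1) * fact (nat (int n + \<mu>))"
          "(fact (nat (int n - \<mu> + 1 + 1)) :: real) = (real n - \<mu> + 2) * ((real n - \<mu> + 1) * fact (nat (int n - \<mu>)))"
          "(fact (nat (int n + \<mu> + 1 + 1)) :: real) = (real n + \<mu> + 2) * ((real n + \<mu> + 1) * fact (nat (int n + \<mu>)))"
    using p fact_nat_Suc[of "int n - \<mu>"] fact_nat_Suc[of "int n + \<mu>"]
      fact_nat_Suc[of "int n - \<mu> + 1"] fact_nat_Suc[of "int n + \<mu> + 1"] by simp_all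
  have e: "int (Suc n) - \<mu> = int n - \<mu> + 1" "int (Suc n) + \<mu> = int n + \<mu> + 1"
    "int (Suc n) - (\<mu> - 1) = int n - \<mu> + 1 + 1" "int (Suc n) + (\<mu> - 1) = int n + \<mu>"
    "int (Suc n) - (\<mu> + 1) = int n - \<mu>" "int (Suc n) + (\<mu> + 1) = int n + \<mu> + 1 + 1"
    by simp_all
  show "solid_norm2 (Suc n) \<mu> = (real n + 1 - \<mu>) * (real n + 1 + \<mu>) * solid_norm2 n \<mu>"
    unfolding solid_norm2_def e f by (simp add: add.commute add.left_commute diff_add_eq)
  show "solid_norm2 (Suc n) (\<mu> - 1) = (real n - \<mu> + 2) * (real n - \<mu> + 1) * solid_norm2 n \<mu>"
    unfolding solid_norm2_def e f by simp
  show "solid_norm2 (Suc n) (\<mu> + 1) = (real n + \<mu> + 2) * (real n + \<mu> + 1) * solid_norm2 n \<mu>"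
    unfolding solid_norm2_def e f by simp
qed

text \<open>
  The argument \<open>s\<close> stands for \<open>1 / |x|\<close>. It is kept separate because it involves a square root, whose
  branch has to be followed along a complex line.
\<close>
definition irreg :: "nat \<Rightarrow> int \<Rightarrow> complex \<Rightarrow> complex \<Rightarrow> complex \<Rightarrow> complex \<Rightarrow> complex" where
  "irreg l m z v w s = of_real (solid_norm2 l m) * solid l m z v w * s ^ (2 * l + 1)"

lemma has_field_derivative_solid:
  fixes z v w :: "complex \<Rightarrow> complex"
  assumes "(z has_field_derivative z') (at x)" "(v has_field_derivative v') (at x)"
    "(w has_field_derivative w') (at x)"
  shows "((\<lambda>x. solid n \<mu> (z x) (v x) (w x)) has_field_derivative
     (solid_pred n \<mu> (z x) (v x) (w x) * z' + solid_pred n (\<mu> - 1) (z x) (v x) (w x) * v'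
        + solid_pred n (\<mu> + 1) (z x) (v x) (w x) * w')) (at x)"
  using has_derivative_solid[OF assms[unfolded has_field_derivative_def], of n \<mu>]
  unfolding has_field_derivative_def
  by (rule has_derivative_eq_rhs) (simp add: fun_eq_iff algebra_simps)

text \<open>
  The three-term relations turn each partial derivative into a single irregular harmonic of the next
  degree. The assumed value of \<open>s'\<close> is what implicit differentiation of \<open>s\<^sup>2 |x|\<^sup>2 = 1\<close> gives.
\<close>
lemma has_field_derivative_irreg:
  fixes z v w s :: "complex \<Rightarrow> complex"
  assumes d: "(z has_field_derivative z') (at x)" "(v has_field_derivative v') (at x)"
    "(w has_field_derivative w') (at x)"
    and ds: "(s has_field_derivative s') (at x)"
    and s': "s' = - (s x ^ 3 * (z x * z' - 2 * v' * w x - 2 * v x * w'))"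
    and s: "(s x)\<^sup>2 * ((z x)\<^sup>2 - 4 * v x * w x) = 1"
    and m: "\<bar>m\<bar> \<le> int l"
  shows "((\<lambda>x. irreg l m (z x) (v x) (w x) (s x)) has_field_derivative
     (- z' * irreg (Suc l) m (z x) (v x) (w x) (s x) + v' * irreg (Suc l) (m - 1) (z x) (v x) (w x) (s x)
        + w' * irreg (Suc l) (m + 1) (z x) (v x) (w x) (s x))) (at x)"
proof -
  define S where "S = solid l m (z x) (v x) (w x)"
  define P where "P = solid_pred l m (z x) (v x) (w x)"
  define Pm where "Pm = solid_pred l (m - 1) (z x) (v x) (w x)"
  define Pp where "Pp = solid_pred l (m + 1) (z x) (v x) (w x)"
  define N :: complex where "N = of_real (solid_norm2 l m)"
  define L :: complex where "L = 2 * of_nat l + 1"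
  define \<sigma> where "\<sigma> = s x"
  have s1: "\<sigma>\<^sup>2 * ((z x)\<^sup>2 - 4 * v x * w x) = 1" using s by (simp add: \<sigma>_def)
  define D where "D = N * ((P * z' + Pm * v' + Pp * w') * \<sigma> ^ (2 * l + 1)
        + S * (L * \<sigma> ^ (2 * l) * s'))"
  have "((\<lambda>x. irreg l m (z x) (v x) (w x) (s x)) has_field_derivative D) (at x)"
    unfolding irreg_def mult.assoc D_def S_def P_def Pm_def Pp_def N_def \<sigma>_def
    by (rule derivative_eq_intros has_field_derivative_solid d ds refl)+
       (simp add: L_def algebra_simps)
  moreover have up: "irreg (Suc l) m (z x) (v x) (w x) \<sigma>
        = N * (L * z x * S - ((z x)\<^sup>2 - 4 * v x * w x) * P) * \<sigma> ^ (2 * l) * \<sigma> ^ 3"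
     "irreg (Suc l) (m - 1) (z x) (v x) (w x) \<sigma>
        = N * (((z x)\<^sup>2 - 4 * v x * w x) * Pm + 2 * L * w x * S) * \<sigma> ^ (2 * l) * \<sigma> ^ 3"
     "irreg (Suc l) (m + 1) (z x) (v x) (w x) \<sigma>
        = N * (((z x)\<^sup>2 - 4 * v x * w x) * Pp + 2 * L * v x * S) * \<sigma> ^ (2 * l) * \<sigma> ^ 3"
  proof -
    have pw: "\<sigma> ^ (2 * Suc l + 1) = \<sigma> ^ (2 * l) * \<sigma> ^ 3"
      by (simp add: power_add [symmetric] del: mult_Suc mult_Suc_right) (simp add: eval_nat_numeral)
    show "irreg (Suc l) m (z x) (v x) (w x) \<sigma>
        = N * (L * z x * S - ((z x)\<^sup>2 - 4 * v x * w x) * P) * \<sigma> ^ (2 * l) * \<sigma> ^ 3"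
      unfolding L_def S_def P_def solid_three_term[symmetric] irreg_def solid_norm2_Suc[OF m] pw N_def
      by simp
    show "irreg (Suc l) (m - 1) (z x) (v x) (w x) \<sigma>
        = N * (((z x)\<^sup>2 - 4 * v x * w x) * Pm + 2 * L * w x * S) * \<sigma> ^ (2 * l) * \<sigma> ^ 3"
      unfolding L_def S_def Pm_def solid_three_term_minus[symmetric] irreg_def solid_norm2_Suc[OF m] pw N_def
      by simp
    show "irreg (Suc l) (m + 1) (z x) (v x) (w x) \<sigma>
        = N * (((z x)\<^sup>2 - 4 * v x * w x) * Pp + 2 * L * v x * S) * \<sigma> ^ (2 * l) * \<sigma> ^ 3"
      unfolding L_def S_def Pp_def solid_three_term_plus[symmetric] irreg_def solid_norm2_Suc[OF m] pw N_def
      by simp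
  qed
  moreover have "D = - z' * irreg (Suc l) m (z x) (v x) (w x) \<sigma> + v' * irreg (Suc l) (m - 1) (z x) (v x) (w x) \<sigma>
        + w' * irreg (Suc l) (m + 1) (z x) (v x) (w x) \<sigma>"
  proof -
    have "D = N * \<sigma> ^ (2 * l) * ((P * z' + Pm * v' + Pp * w') * \<sigma>
        - S * L * (\<sigma> ^ 3 * (z x * z' - 2 * v' * w x - 2 * v x * w')))"
      by (simp add: D_def s' \<sigma>_def algebra_simps)
    also have "(P * z' + Pm * v' + Pp * w') * \<sigma> - S * L * (\<sigma> ^ 3 * (z x * z' - 2 * v' * w x - 2 * v x * w'))
       = \<sigma> ^ 3 * (- z' * (L * z x * S - ((z x)\<^sup>2 - 4 * v x * w x) * P)
          + v' * (((z x)\<^sup>2 - 4 * v x * w x) * Pm + 2 * L * w x * S)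
          + w' * (((z x)\<^sup>2 - 4 * v x * w x) * Pp + 2 * L * v x * S))"
      using s1 by algebra
    finally show ?thesis unfolding up by (simp add: algebra_simps)
  qed
  ultimately show ?thesis by (simp add: \<sigma>_def)
qed

text \<open>Harmonics of order beyond the degree vanish, so the enlarged range absorbs a shift by one.\<close>
lemma sum_solid_shift:
  assumes "\<bar>c\<bar> \<le> 1"
  shows "(\<Sum>\<mu>=-int n..int n. g \<mu> * solid n \<mu> z v w)
       = (\<Sum>\<mu>=-int (Suc n)..int (Suc n). g (\<mu> + c) * solid n (\<mu> + c) z v w)"
proof -
  have "(\<Sum>\<mu>=-int (Suc n)..int (Suc n). g (\<mu> + c) * solid n (\<mu> + c) z v w)
      = (\<Sum>\<mu>=-int (Suc n)+c..int (Suc n)+c. g \<mu> * solid n \<mu> z v w)"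
    by (rule sum.reindex_bij_witness[of _ "\<lambda>\<mu>. \<mu> - c" "\<lambda>\<mu>. \<mu> + c"]) auto
  also have "\<dots> = (\<Sum>\<mu>=-int n..int n. g \<mu> * solid n \<mu> z v w)"
    using assms by (intro sum.mono_neutral_right) (auto simp: not_le intro!: solid_eq_0)
  finally show ?thesis ..
qed

text \<open>
  Summation by parts: the recursion of \<open>solid\<close> is traded for shifts of the coefficients \<open>g\<close>, which is
  how a further derivative along a line acts on them.
\<close>
lemma sum_solid_Suc:
  "of_nat (Suc n) * (\<Sum>\<mu>=-int (Suc n)..int (Suc n). g \<mu> * solid (Suc n) \<mu> z v w)
   = (\<Sum>\<mu>=-int n..int n. (z * g \<mu> + v * g (\<mu> + 1) + w * g (\<mu> - 1)) * solid n \<mu> z v w)"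
proof -
  have rec: "of_nat (Suc n) * solid (Suc n) \<mu> z v w
      = z * solid n \<mu> z v w + v * solid n (\<mu> - 1) z v w + w * solid n (\<mu> + 1) z v w" for \<mu>
    by (simp del: of_nat_Suc)
  have "(\<Sum>\<mu>=-int n..int n. (z * g \<mu> + v * g (\<mu> + 1) + w * g (\<mu> - 1)) * solid n \<mu> z v w)
     = (\<Sum>\<mu>=-int n..int n. (z * g \<mu>) * solid n \<mu> z v w)
     + (\<Sum>\<mu>=-int n..int n. (v * g (\<mu> + 1)) * solid n \<mu> z v w)
     + (\<Sum>\<mu>=-int n..int n. (w * g (\<mu> - 1)) * solid n \<mu> z v w)"
    by (simp add: sum.distrib algebra_simps)
  also have "\<dots> = (\<Sum>\<mu>=-int (Suc n)..int (Suc n). g \<mu> * (of_nat (Suc n) * solid (Suc n) \<mu> z v w))"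
    by (subst sum_solid_shift[of 0], simp, subst sum_solid_shift[of "-1"], simp,
        subst sum_solid_shift[of 1], simp)
       (simp add: rec sum.distrib [symmetric] ring_distribs mult_ac del: of_nat_Suc solid.simps)
  finally show ?thesis
    by (simp add: sum_distrib_left mult_ac del: of_nat_Suc solid.simps)
qed

text \<open>
  The expansion is the Taylor series at \<open>0\<close> of \<open>t \<mapsto> irreg l m (a + t r)\<close>, evaluated at \<open>1\<close>. As every
  derivative in \<open>t\<close> is a combination of irregular harmonics of the next degree, the \<open>n\<close>-th one is
  \<open>n!\<close> times the summand with index \<open>n\<close>.
\<close>
lemma irreg_addition_complex:
  fixes az av aw rz rv rw :: complex
  defines "Q \<equiv> \<lambda>t. (az + t * rz)\<^sup>2 - 4 * (av + t * rv) * (aw + t * rw)"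
  assumes Q: "\<And>t. norm t < \<rho> \<Longrightarrow> Q t \<notin> \<real>\<^sub>\<le>\<^sub>0" and \<rho>: "\<rho> > 1" and m: "\<bar>m\<bar> \<le> int l"
  shows "(\<lambda>n. \<Sum>\<mu>=-int n..int n. ((-1) powi (int n + \<mu>) * irreg (l + n) (m - \<mu>) az av aw (1 / csqrt (Q 0)))
              * solid n \<mu> rz rv rw)
           sums irreg l m (az + rz) (av + rv) (aw + rw) (1 / csqrt (Q 1))"
proof -
  define s where "s = (\<lambda>t. 1 / csqrt (Q t))"
  define F where "F = (\<lambda>l m t. irreg l m (az + t * rz) (av + t * rv) (aw + t * rw) (s t))"
  define T where "T = (\<lambda>n l m t. \<Sum>\<mu>=-int n..int n. ((-1) powi (int n + \<mu>) * F (l + n) (m - \<mu>) t)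
              * solid n \<mu> rz rv rw)"
  have s: "(s t)\<^sup>2 * ((az + t * rz)\<^sup>2 - 4 * (av + t * rv) * (aw + t * rw)) = 1"
    if "norm t < \<rho>" for t
    using Q[OF that] by (auto simp: s_def Q_def power_divide)
  have ds: "(s has_field_derivative
      - (s t ^ 3 * ((az + t * rz) * rz - 2 * rv * (aw + t * rw) - 2 * (av + t * rv) * rw))) (at t)"
    if "norm t < \<rho>" for t
  proof -
    define D where "D = (az + t * rz) * rz - 2 * rv * (aw + t * rw) - 2 * (av + t * rv) * rw"
    have "(Q has_field_derivative 2 * D) (at t)"
      unfolding Q_def D_def
      by (rule derivative_eq_intros refl)+ (simp add: algebra_simps)
    from DERIV_chain2[OF has_field_derivative_csqrt[OF Q[OF that]] this]
    have d: "((\<lambda>t. csqrt (Q t)) has_field_derivative D / csqrt (Q t)) (at t)"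
      by (rule DERIV_cong) (simp add: field_simps)
    have nz: "csqrt (Q t) \<noteq> 0" using Q[OF that] by auto
    show ?thesis unfolding s_def D_def [symmetric]
      by (rule derivative_eq_intros d nz refl)+ (use nz in \<open>simp add: field_simps eval_nat_numeral\<close>)
  qed
  have dF: "(F l m has_field_derivative
      - rz * F (Suc l) m t + rv * F (Suc l) (m - 1) t + rw * F (Suc l) (m + 1) t) (at t)"
    if "norm t < \<rho>" "\<bar>m\<bar> \<le> int l" for l m t
    unfolding F_def
    by (rule has_field_derivative_irreg[OF _ _ _ ds[OF that(1)] _ _ that(2)])
       (use s[OF that(1)] in \<open>auto intro!: derivative_eq_intros\<close>)
  have dT: "(T n l m has_field_derivative of_nat (Suc n) * T (Suc n) l m t) (at t)"
    if t: "norm t < \<rho>" and "\<bar>m\<bar> \<le> int l" for l m n t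
  proof -
    have 1: "(T n l m has_field_derivative (\<Sum>\<mu>=-int n..int n. ((-1) powi (int n + \<mu>) *
        (- rz * F (Suc (l + n)) (m - \<mu>) t + rv * F (Suc (l + n)) (m - \<mu> - 1) t
          + rw * F (Suc (l + n)) (m - \<mu> + 1) t)) * solid n \<mu> rz rv rw)) (at t)"
      unfolding T_def
      by (intro DERIV_sum DERIV_cmult DERIV_cmult_right dF t) (use that in auto)
    have "of_nat (Suc n) * T (Suc n) l m t = (\<Sum>\<mu>=-int n..int n.
        (rz * ((-1) powi (int (Suc n) + \<mu>) * F (l + Suc n) (m - \<mu>) t)
        + rv * ((-1) powi (int (Suc n) + (\<mu> + 1)) * F (l + Suc n) (m - (\<mu> + 1)) t)
        + rw * ((-1) powi (int (Suc n) + (\<mu> - 1)) * F (l + Suc n) (m - (\<mu> - 1)) t)) * solid n \<mu> rz rv rw)"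
      unfolding T_def by (rule sum_solid_Suc)
    also have "\<dots> = (\<Sum>\<mu>=-int n..int n. ((-1) powi (int n + \<mu>) *
        (- rz * F (Suc (l + n)) (m - \<mu>) t + rv * F (Suc (l + n)) (m - \<mu> - 1) t
          + rw * F (Suc (l + n)) (m - \<mu> + 1) t)) * solid n \<mu> rz rv rw)"
      by (rule sum.cong) (simp_all add: power_int_add power_int_diff algebra_simps)
    finally show ?thesis using 1 by simp
  qed
  have deriv: "(deriv ^^ n) (F l m) t = fact n * T n l m t" if "norm t < \<rho>" for n t
    using that
  proof (induction n arbitrary: t)
    case 0
    show ?case by (simp add: T_def)
  next
    case (Suc n)
    have "(deriv ^^ Suc n) (F l m) t = deriv (\<lambda>t. fact n * T n l m t) t"
      unfolding funpow.simps o_def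
    proof (rule deriv_cong_ev)
      have "\<forall>\<^sub>F t in nhds t. t \<in> ball 0 \<rho>"
        using Suc.prems by (intro eventually_nhds_in_open) auto
      then show "\<forall>\<^sub>F t in nhds t. (deriv ^^ n) (F l m) t = fact n * T n l m t"
        by eventually_elim (simp add: Suc.IH)
    qed simp
    also have "\<dots> = fact n * (of_nat (Suc n) * T (Suc n) l m t)"
      by (intro DERIV_imp_deriv DERIV_cmult dT Suc.prems m)
    finally show ?case by (simp add: algebra_simps)
  qed
  \<comment> \<open>Here the radius of convergence is used: the disc contains \<open>1\<close>.\<close>
  have "F l m holomorphic_on ball 0 \<rho>"
    using dF[OF _ m] unfolding holomorphic_on_open[OF open_ball] by (metis dist_0_norm mem_ball)
  from holomorphic_power_series[OF this, of 1] \<rho>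
  have "(\<lambda>n. (deriv ^^ n) (F l m) 0 / fact n * (1 - 0) ^ n) sums F l m 1"
    by simp
  also have "(\<lambda>n. (deriv ^^ n) (F l m) 0 / fact n * (1 - 0) ^ n) = (\<lambda>n. T n l m 0)"
    using deriv[of 0] \<rho> by simp
  finally show ?thesis by (simp add: T_def F_def s_def)
qed

text \<open>
  The complex coordinates of a real point. Up to the factor \<open>sqrt 2\<close>, the last two are its spherical
  components of index \<open>1\<close> and \<open>-1\<close>.
\<close>
definition coord_z :: "real ^ 3 \<Rightarrow> complex" where "coord_z x = of_real (x $ 3)"
definition coord_v :: "real ^ 3 \<Rightarrow> complex" where "coord_v x = - Complex (x $ 1) (x $ 2) / 2"
definition coord_w :: "real ^ 3 \<Rightarrow> complex" where "coord_w x = Complex (x $ 1) (- (x $ 2)) / 2"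

definition solid_at :: "nat \<Rightarrow> int \<Rightarrow> real ^ 3 \<Rightarrow> complex" where
  "solid_at n \<mu> x = solid n \<mu> (coord_z x) (coord_v x) (coord_w x)"

definition irreg_at :: "nat \<Rightarrow> int \<Rightarrow> real ^ 3 \<Rightarrow> complex" where
  "irreg_at l m x = irreg l m (coord_z x) (coord_v x) (coord_w x) (1 / of_real (norm x))"

lemma coords_add: "coord_z (x + y) = coord_z x + coord_z y" "coord_v (x + y) = coord_v x + coord_v y" "coord_w (x + y) = coord_w x + coord_w y"
  by (simp_all add: coord_z_def coord_v_def coord_w_def complex_eq_iff field_simps)

lemma coords_scaleR: "coord_z (c *\<^sub>R x) = of_real c * coord_z x" "coord_v (c *\<^sub>R x) = of_real c * coord_v x"
    "coord_w (c *\<^sub>R x) = of_real c * coord_w x"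
  by (simp_all add: coord_z_def coord_v_def coord_w_def complex_eq_iff)

lemma inner_3: "x \<bullet> y = x $ 1 * y $ 1 + x $ 2 * y $ 2 + x $ 3 * (y :: real ^ 3) $ 3"
  by (simp add: inner_vec_def sum_3)

lemma coords_inner: "coord_z x * coord_z y - 2 * coord_v x * coord_w y - 2 * coord_v y * coord_w x = of_real (x \<bullet> y)"
  by (simp add: coord_z_def coord_v_def coord_w_def complex_eq_iff inner_3 field_simps)

lemma coords_norm: "(coord_z x)\<^sup>2 - 4 * coord_v x * coord_w x = of_real ((norm x)\<^sup>2)"
  unfolding power2_norm_eq_inner coords_inner [symmetric]
  by (simp add: power2_eq_square algebra_simps)

text \<open>
  If the value were \<open>-c\<close> with \<open>c \<ge> 0\<close>, then \<open>t\<close> would be a root of a real quadratic with constant term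
  \<open>A + c\<close>, leading coefficient \<open>R\<close> and no two distinct real roots. The product of its two conjugate
  roots is \<open>|t|\<^sup>2 = (A + c) / R \<ge> A / R\<close>.
\<close>
lemma quadratic_notin_nonpos:
  fixes A B R :: real and t :: complex
  assumes "R > 0" "B\<^sup>2 \<le> A * R" "(cmod t)\<^sup>2 * R < A"
  shows "of_real A + 2 * t * of_real B + t\<^sup>2 * of_real R \<notin> \<real>\<^sub>\<le>\<^sub>0"
proof
  assume "of_real A + 2 * t * of_real B + t\<^sup>2 * of_real R \<in> \<real>\<^sub>\<le>\<^sub>0"
  then have re: "A + 2 * Re t * B + ((Re t)\<^sup>2 - (Im t)\<^sup>2) * R \<le> 0"
    and im: "2 * Im t * (B + Re t * R) = 0"
    by (auto simp: complex_nonpos_Reals_iff power2_eq_square algebra_simps)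
  have t: "((Re t)\<^sup>2 + (Im t)\<^sup>2) * R < A" using assms(3) by (simp add: cmod_power2)
  have B: "B = - Re t * R"
  proof (cases "Im t = 0")
    case True
    have "(Re t * R + B)\<^sup>2 + (A * R - B\<^sup>2) = R * (A + 2 * Re t * B + ((Re t)\<^sup>2 - (Im t)\<^sup>2) * R)"
      using True by (simp add: power2_eq_square algebra_simps)
    also have "\<dots> \<le> 0" using re assms(1) by (simp add: mult_nonneg_nonpos)
    finally have "(Re t * R + B)\<^sup>2 \<le> 0" using assms(2) by linarith
    then have "Re t * R + B = 0" by simp
    then show ?thesis by linarith
  qed (use im in auto)
  with re have "A \<le> ((Re t)\<^sup>2 + (Im t)\<^sup>2) * R"
    by (simp add: power2_eq_square algebra_simps)
  with t show False by simp
qed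

theorem irreg_addition:
  fixes r a :: "real ^ 3"
  assumes ra: "norm r < norm a" and r: "norm r > 0" and m: "\<bar>m\<bar> \<le> int l"
  shows "(\<lambda>n. \<Sum>\<mu>=-int n..int n. ((-1) powi (int n + \<mu>) * irreg_at (l + n) (m - \<mu>) a) * solid_at n \<mu> r)
           sums irreg_at l m (a + r)"
proof -
  define Q where "Q = (\<lambda>t. (coord_z a + t * coord_z r)\<^sup>2 - 4 * (coord_v a + t * coord_v r) * (coord_w a + t * coord_w r))"
  have Q: "Q t = of_real ((norm a)\<^sup>2) + 2 * t * of_real (a \<bullet> r) + t\<^sup>2 * of_real ((norm r)\<^sup>2)" for t
    unfolding Q_def coords_norm [symmetric] coords_inner [symmetric]
    by (simp add: algebra_simps power2_eq_square)
  have "Q t \<notin> \<real>\<^sub>\<le>\<^sub>0" if "cmod t < norm a / norm r" for t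
    unfolding Q
  proof (rule quadratic_notin_nonpos)
    show "(a \<bullet> r)\<^sup>2 \<le> (norm a)\<^sup>2 * (norm r)\<^sup>2"
      using Cauchy_Schwarz_ineq[of a r] by (simp add: power2_norm_eq_inner)
    have "cmod t * norm r < norm a" using that r by (simp add: field_simps)
    then have "(cmod t * norm r)\<^sup>2 < (norm a)\<^sup>2"
      by (intro power_strict_mono) auto
    then show "(cmod t)\<^sup>2 * (norm r)\<^sup>2 < (norm a)\<^sup>2" by (simp add: power_mult_distrib)
  qed (use r in simp)
  moreover have "norm a / norm r > 1" using ra r by simp
  ultimately have "(\<lambda>n. \<Sum>\<mu>=-int n..int n. ((-1) powi (int n + \<mu>) *
        irreg (l + n) (m - \<mu>) (coord_z a) (coord_v a) (coord_w a) (1 / csqrt (Q 0))) * solid n \<mu> (coord_z r) (coord_v r) (coord_w r))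
           sums irreg l m (coord_z a + coord_z r) (coord_v a + coord_v r) (coord_w a + coord_w r) (1 / csqrt (Q 1))"
    unfolding Q_def by (intro irreg_addition_complex m)
  moreover have "csqrt (Q 0) = of_real (norm a)"
    by (simp add: Q flip: of_real_power)
  moreover have "csqrt (Q 1) = of_real (norm (a + r))"
  proof -
    have "Q 1 = of_real ((norm (a + r))\<^sup>2)"
      unfolding coords_norm[symmetric] by (simp add: Q_def coords_add)
    then show ?thesis by (simp flip: of_real_power)
  qed
  ultimately show ?thesis
    by (simp add: irreg_at_def solid_at_def coords_add)
qed

section \<open>Spherical harmonics as solid harmonics\<close>

text \<open>Leibniz' rule; only three terms survive, as the first factor is quadratic.\<close>
lemma pderiv_funpow_quadratic_mult:
  fixes f :: "real poly"
  shows "(pderiv ^^ j) ([:-1, 0, 1:] * f) = [:-1, 0, 1:] * (pderiv ^^ j) f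
    + smult (2 * of_nat j) ([:0, 1:] * (pderiv ^^ (j - 1)) f)
    + smult (of_nat j * (of_nat j - 1)) ((pderiv ^^ (j - 2)) f)"
proof -
  define q X :: "real poly" where "q = [:-1, 0, 1:]" and "X = [:0, 1:]"
  have q: "pderiv q = smult 2 X" "pderiv X = 1"
    by (simp_all add: q_def X_def pderiv_pCons)
  have "(pderiv ^^ j) (q * f) = q * (pderiv ^^ j) f
    + smult (2 * of_nat j) (X * (pderiv ^^ (j - 1)) f)
    + smult (of_nat j * (of_nat j - 1)) ((pderiv ^^ (j - 2)) f)"
  proof (induction j)
    case (Suc j)
    have D1: "pderiv (smult (2 * of_nat j) (X * (pderiv ^^ (j - 1)) f))
        = smult (2 * of_nat j) (X * (pderiv ^^ j) f + (pderiv ^^ (j - 1)) f)"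
      by (cases j) (simp_all add: pderiv_smult pderiv_mult q)
    have D2: "pderiv (smult (of_nat j * (of_nat j - 1)) ((pderiv ^^ (j - 2)) f))
        = smult (of_nat j * (of_nat j - 1)) ((pderiv ^^ (j - 1)) f)"
    proof (cases "j \<ge> 2")
      case True
      then have "j - 1 = Suc (j - 2)" by simp
      then show ?thesis by (simp add: pderiv_smult)
    next
      case False
      then have "j = 0 \<or> j = 1" by auto
      then show ?thesis by auto
    qed
    have "(pderiv ^^ Suc j) (q * f) = pderiv ((pderiv ^^ j) (q * f))"
      by simp
    also have "\<dots> = q * (pderiv ^^ Suc j) f
      + smult (2 * of_nat (Suc j)) (X * (pderiv ^^ (Suc j - 1)) f)
      + smult (of_nat (Suc j) * (of_nat (Suc j) - 1)) ((pderiv ^^ (Suc j - 2)) f)"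
      unfolding Suc.IH pderiv_add D1 D2 pderiv_mult q
      by (rule poly_eqI) (simp add: algebra_simps numeral_2_eq_2)
    finally show ?case .
  qed simp
  then show ?thesis by (simp only: q_def X_def)
qed

text \<open>
  The Taylor coefficient of order \<open>j\<close> at \<open>x\<close> of \<open>(X\<^sup>2 - 1) ^ n / n!\<close>. Negative orders are admitted, with
  value \<open>0\<close>, to keep the recurrence free of boundary cases.
\<close>
definition rodrigues_coeff :: "real \<Rightarrow> nat \<Rightarrow> int \<Rightarrow> real" where
  "rodrigues_coeff x n j =
     (if j < 0 then 0 else poly ((pderiv ^^ nat j) ([:-1, 0, 1:] ^ n)) x / (fact n * fact (nat j)))"

lemma rodrigues_coeff_0: "rodrigues_coeff x 0 j = (if j = 0 then 1 else 0)"
proof -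
  have "(pderiv ^^ Suc k) (1 :: real poly) = 0" for k
    by (induction k) auto
  then have "(pderiv ^^ nat j) (1 :: real poly) = 0" if "j > 0"
    using that by (metis gr0_implies_Suc zero_less_nat_eq)
  then show ?thesis by (auto simp: rodrigues_coeff_def)
qed

lemma rodrigues_coeff_Suc:
  "real (Suc n) * rodrigues_coeff x (Suc n) j =
     (x\<^sup>2 - 1) * rodrigues_coeff x n j + 2 * x * rodrigues_coeff x n (j - 1) + rodrigues_coeff x n (j - 2)"
proof (cases "j < 0")
  case False
  define k where "k = nat j"
  have j: "j = int k" using False by (simp add: k_def)
  define q where "q = [:-1, 0, 1 :: real:] ^ n"
  define d where "d = (\<lambda>k. poly ((pderiv ^^ k) q) x)"
  have "poly ((pderiv ^^ k) ([:-1, 0, 1:] ^ Suc n)) x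
      = (x\<^sup>2 - 1) * d k + 2 * k * x * d (k - 1) + k * (real k - 1) * d (k - 2)"
    unfolding power_Suc q_def[symmetric] pderiv_funpow_quadratic_mult
    by (simp add: d_def power2_eq_square algebra_simps)
  then have "real (Suc n) * rodrigues_coeff x (Suc n) j
      = ((x\<^sup>2 - 1) * d k + 2 * k * x * d (k - 1) + k * (real k - 1) * d (k - 2)) / (fact n * fact k)"
    unfolding rodrigues_coeff_def j by (simp del: power_Suc of_nat_Suc add: field_simps)
  moreover have "rodrigues_coeff x n j = d k / (fact n * fact k)"
    by (simp add: rodrigues_coeff_def j d_def q_def)
  moreover have "rodrigues_coeff x n (j - 1) = k * d (k - 1) / (fact n * fact k)"
    by (cases k) (simp_all add: rodrigues_coeff_def j d_def q_def nat_diff_distrib del: of_nat_Suc)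
  moreover have "rodrigues_coeff x n (j - 2) = k * (real k - 1) * d (k - 2) / (fact n * fact k)"
  proof (cases "k \<le> 1")
    case True
    then have "k = 0 \<or> k = 1" by auto
    then show ?thesis by (auto simp: rodrigues_coeff_def j)
  next
    case False
    then obtain i where i: "k = Suc (Suc i)"
      by (metis One_nat_def le_0_eq le_SucI nat.exhaust order_refl)
    have "real k - 1 = real (Suc i)" by (simp add: i)
    moreover have "nat (j - 2) = i" "\<not> j - 2 < 0" using j i by auto
    ultimately show ?thesis by (simp add: rodrigues_coeff_def i d_def q_def del: funpow.simps)
  qed
  ultimately show ?thesis
    by (simp only: add_divide_distrib times_divide_eq_right of_nat_mult of_nat_numeral mult_ac)
qed (simp add: rodrigues_coeff_def)

text \<open>
  On the unit sphere \<open>z + v u + w / u = ((2 v u + z)\<^sup>2 - 1) / (4 v u)\<close>. Hence the coefficients in \<open>u\<close> of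
  the \<open>n\<close>-th power are the Taylor coefficients of \<open>(X\<^sup>2 - 1) ^ n\<close> at \<open>z\<close>, which are the derivatives in
  Rodrigues' formula. The proof compares recurrences in \<open>n\<close>.
\<close>
lemma solid_eq_rodrigues:
  assumes "v \<noteq> 0" "(of_real x)\<^sup>2 - 4 * v * w = 1"
  shows "solid n k (of_real x) v w = (2 * v) powi k / 2 ^ n * of_real (rodrigues_coeff x n (int n + k))"
proof (induction n arbitrary: k)
  case 0
  show ?case by (simp add: rodrigues_coeff_0)
next
  case (Suc n)
  define B where "B = (\<lambda>k. complex_of_real (rodrigues_coeff x n (int n + k)))"
  define V where "V = (2 * v) powi k"
  have V: "(2 * v) powi (k - 1) = V / (2 * v)" "(2 * v) powi (k + 1) = V * (2 * v)"
    using assms(1) by (simp_all add: V_def power_int_diff power_int_add)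
  have "of_real (real (Suc n) * rodrigues_coeff x (Suc n) (int (Suc n) + k))
     = (of_real x ^ 2 - 1) * B (k + 1) + 2 * of_real x * B k + B (k - 1)"
    unfolding rodrigues_coeff_Suc B_def by (simp add: add_ac algebra_simps)
  also have "of_real x ^ 2 - 1 = 4 * v * w" using assms(2) by algebra
  finally have B: "of_nat (Suc n) * of_real (rodrigues_coeff x (Suc n) (int (Suc n) + k))
    = 4 * v * w * B (k + 1) + 2 * of_real x * B k + B (k - 1)"
    by (simp del: of_nat_Suc)
  have "of_nat (Suc n) * solid (Suc n) k (of_real x) v w
     = of_real x * (V / 2 ^ n * B k) + v * (V / (2 * v) / 2 ^ n * B (k - 1))
        + w * (V * (2 * v) / 2 ^ n * B (k + 1))"
    using Suc.IH[of k, folded V_def] Suc.IH[of "k - 1", unfolded V] Suc.IH[of "k + 1", unfolded V]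
    by (simp add: B_def del: of_nat_Suc)
  also have "\<dots> = V / 2 ^ Suc n * (of_nat (Suc n) * of_real (rodrigues_coeff x (Suc n) (int (Suc n) + k)))"
    unfolding B using assms(1) by (simp add: field_simps)
  finally show ?case
    unfolding V_def
    by (metis mult.left_commute mult_cancel_left of_nat_neq_0)
qed

text \<open>
  The points with \<open>v = 0\<close>, where the preceding lemma would divide by zero, are the poles of the sphere;
  there \<open>x\<close> is a root of \<open>X\<^sup>2 - 1\<close>.
\<close>
lemma rodrigues_coeff_pole:
  assumes "x\<^sup>2 = 1"
  shows "rodrigues_coeff x n j = (if j = int n then (2 * x) ^ n / fact n else 0) \<or> j > int n"
proof (induction n arbitrary: j)
  case 0
  show ?case by (simp add: rodrigues_coeff_0)
next
  case (Suc n)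
  show ?case
  proof (cases "j > int (Suc n)")
    case False
    have "real (Suc n) * rodrigues_coeff x (Suc n) j
       = 2 * x * rodrigues_coeff x n (j - 1) + rodrigues_coeff x n (j - 2)"
      unfolding rodrigues_coeff_Suc using assms by simp
    also have "\<dots> = (if j = int (Suc n) then 2 * x * (2 * x) ^ n / fact n else 0)"
      using Suc.IH[of "j - 1"] Suc.IH[of "j - 2"] False by auto
    finally have "rodrigues_coeff x (Suc n) j
        = (if j = int (Suc n) then 2 * x * (2 * x) ^ n / fact n else 0) / real (Suc n)"
      by (subst eq_divide_eq) (simp add: mult.commute del: of_nat_Suc)
    then show ?thesis by (simp add: mult_ac)
  qed simp
qed

lemma solid_pole: "solid n \<mu> z 0 0 = (if \<mu> = 0 then z ^ n / fact n else 0)"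
  by (induction n arbitrary: \<mu>) (auto simp: field_simps)

lemma solid_eq_rodrigues_nonneg:
  assumes "(of_real x)\<^sup>2 - 4 * v * w = 1" "v = 0 \<Longrightarrow> w = 0"
  shows "solid n (int k) (of_real x) v w
    = (2 * v) ^ k / 2 ^ n * of_real (rodrigues_coeff x n (int n + int k))"
proof (cases "v = 0")
  case True
  with assms have "x\<^sup>2 = 1" by (simp flip: of_real_power)
  from rodrigues_coeff_pole[OF this, of n "int n"]
  have "rodrigues_coeff x n (int n) = (2 * x) ^ n / fact n" by simp
  then show ?thesis
    using assms True by (auto simp: solid_pole power_mult_distrib)
next
  case False
  with solid_eq_rodrigues[of v x w n "int k"] assms show ?thesis by simp
qed

text \<open>The ratio between \<open>Y\<close> and \<open>solid\<close> on the unit sphere.\<close>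
definition sph_norm :: "nat \<Rightarrow> int \<Rightarrow> real" where
  "sph_norm n \<mu> = sqrt ((2 * real n + 1) / (4 * pi) * solid_norm2 n \<mu>)"

lemma poly_legendre_deriv:
  "poly ((pderiv ^^ k) (legendre_poly n)) x
     = fact (n + k) / 2 ^ n * rodrigues_coeff x n (int n + int k)"
proof -
  have "(pderiv ^^ k) (smult c p) = smult c ((pderiv ^^ k) p)" for c and p :: "real poly"
    by (induction k) (simp_all add: pderiv_smult)
  moreover have "(pderiv ^^ k) ((pderiv ^^ n) p) = (pderiv ^^ (n + k)) p" for p :: "real poly"
    by (simp add: add.commute funpow_add)
  ultimately show ?thesis
    by (simp add: legendre_poly_def rodrigues_coeff_def nat_add_distrib field_simps)
qed

text \<open>
  For nonnegative order, \<open>2 v = - sin \<theta> e\<^sup>i\<^sup>\<phi>\<close> supplies the phase, the power of \<open>sin \<theta>\<close> and the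
  Condon--Shortley sign at once. Negative orders follow because complex conjugation exchanges \<open>v\<close> and
  \<open>- w\<close>.
\<close>
lemma sph_harm_eq:
  assumes "norm u = 1"
  shows "sph_harm n \<mu> u = of_real (sph_norm n \<mu>) * solid_at n \<mu> u"
proof -
  define k where "k = nat \<bar>\<mu>\<bar>"
  have u: "(u $ 1)\<^sup>2 + (u $ 2)\<^sup>2 + (u $ 3)\<^sup>2 = 1"
    using assms by (metis inner_3 norm_eq_1 power2_eq_square)
  have u3: "\<bar>u $ 3\<bar> \<le> 1" using component_le_norm_cart[of u 3] assms by simp
  define \<phi> where "\<phi> = Arg (Complex (u $ 1) (u $ 2))"
  have s: "sqrt (1 - (u $ 3)\<^sup>2) = cmod (Complex (u $ 1) (u $ 2))"
    using u by (simp add: cmod_def algebra_simps)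
  have v: "2 * coord_v u = - (of_real (sqrt (1 - (u $ 3)\<^sup>2)) * cis \<phi>)"
    unfolding s \<phi>_def using rcis_cmod_Arg[of "Complex (u $ 1) (u $ 2)"]
    by (simp add: rcis_def coord_v_def)
  have vw: "coord_w u = - cnj (coord_v u)" by (simp add: coord_v_def coord_w_def complex_eq_iff)
  define y where "y = complex_of_real (sqrt ((2 * real n + 1) / (4 * pi) * (fact (n - k) / fact (n + k)))
                * assoc_legendre n k (cos (arccos (u $ 3)))) * cis (real k * \<phi>)"
  have sh: "sph_harm n \<mu> u = (if \<mu> \<ge> 0 then y else (-1) ^ k * cnj y)"
    by (simp add: sph_harm_def sph_harm_angles_def y_def k_def \<phi>_def Let_def)
  have "(of_real (u $ 3))\<^sup>2 - 4 * coord_v u * coord_w u = 1"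
    using coords_norm[of u] assms by (simp add: coord_z_def)
  then have sk: "solid n (int k) (of_real (u $ 3)) (coord_v u) (coord_w u)
      = (2 * coord_v u) ^ k / 2 ^ n * of_real (rodrigues_coeff (u $ 3) n (int n + int k))"
    by (rule solid_eq_rodrigues_nonneg) (simp add: vw)
  have "y = of_real (sqrt ((2 * real n + 1) / (4 * pi) * (fact (n - k) / fact (n + k))) * fact (n + k))
      * solid_at n (int k) u"
    unfolding y_def solid_at_def coord_z_def sk v
    using u3 by (simp add: assoc_legendre_def cos_arccos_abs poly_legendre_deriv power_mult_distrib
        Complex.DeMoivre power_minus [of "_ * _"] mult_ac)
  also have "\<dots> = of_real (sph_norm n (int k)) * solid_at n (int k) u"
  proof (cases "k \<le> n")
    case True
    then have "nat (int n - int k) = n - k" "nat (int n + int k) = n + k" by auto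
    then have "sqrt ((2 * real n + 1) / (4 * pi) * (fact (n - k) / fact (n + k))) * fact (n + k) = sph_norm n (int k)"
      unfolding sph_norm_def solid_norm2_def
      by (simp add: real_sqrt_mult real_sqrt_divide) (simp add: field_simps)
    then show ?thesis by simp
  next
    case False
    then show ?thesis by (simp add: solid_at_def solid_eq_0)
  qed
  finally have y: "y = of_real (sph_norm n (int k)) * solid_at n (int k) u" .
  show ?thesis
  proof (cases "\<mu> \<ge> 0")
    case True
    then show ?thesis by (simp add: sh y k_def)
  next
    case False
    then have \<mu>: "\<mu> = - int k" by (simp add: k_def)
    have "cnj (solid_at n (int k) u) = solid n (int k) (coord_z u) (- coord_w u) (- coord_v u)"
      by (simp add: solid_at_def cnj_solid vw) (simp add: coord_z_def)
    also have "\<dots> = (-1) ^ k * solid_at n \<mu> u"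
      by (simp add: solid_rotate \<mu> solid_at_def solid_reflect)
    finally have "(-1) ^ k * cnj (solid_at n (int k) u) = solid_at n \<mu> u"
      by (simp add: power_mult_distrib [symmetric] mult.assoc [symmetric])
    moreover have "sph_norm n (int k) = sph_norm n \<mu>"
      by (simp add: sph_norm_def solid_norm2_def \<mu> mult.commute)
    ultimately show ?thesis using False
      by (simp add: sh y mult.left_commute)
  qed
qed

section \<open>Vector spherical harmonics in the spherical basis\<close>

text \<open>
  The vector \<open>c0 e\<^sub>0 + cp e\<^sub>1 + cm e\<^sub>-\<^sub>1\<close> in the spherical basis \<open>e\<^sub>0 = (0, 0, 1)\<close>, \<open>e\<^sub>1 = - (1, i, 0) / sqrt 2\<close>,
  \<open>e\<^sub>-\<^sub>1 = (1, -i, 0) / sqrt 2\<close>.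
\<close>
definition sph_vec :: "complex \<Rightarrow> complex \<Rightarrow> complex \<Rightarrow> complex ^ 3" where
  "sph_vec c0 cp cm = vector [(cm - cp) / sqrt 2, - \<i> * (cp + cm) / sqrt 2, c0]"

lemma sph_vec_nth [simp]:
  "sph_vec c0 cp cm $ 1 = (cm - cp) / sqrt 2"
  "sph_vec c0 cp cm $ 2 = - \<i> * (cp + cm) / sqrt 2"
  "sph_vec c0 cp cm $ 3 = c0"
  by (simp_all add: sph_vec_def)

lemma sph_vec_linear:
  "sph_vec a b c + sph_vec a' b' c' = sph_vec (a + a') (b + b') (c + c')"
  "d *s sph_vec a b c = sph_vec (d * a) (d * b) (d * c)"
  by (simp_all add: vec_eq_iff forall_3 add_divide_distrib diff_divide_distrib algebra_simps)

lemma sqrt2_sq: "complex_of_real (sqrt 2) * complex_of_real (sqrt 2) = 2"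
  by (simp flip: of_real_mult)

lemma sqrt2_left: "complex_of_real (sqrt 2) * (complex_of_real (sqrt 2) * x) = 2 * x"
  by (simp add: sqrt2_sq flip: mult.assoc)

lemma cvec_sph_vec:
  "cvec u = sph_vec (coord_z u) (- (of_real (sqrt 2) * coord_w u)) (- (of_real (sqrt 2) * coord_v u))"
  by (simp add: vec_eq_iff forall_3 cvec_def coord_z_def coord_v_def coord_w_def complex_eq_iff field_simps)

text \<open>The gradient: \<open>\<nabla>f = \<partial>\<^sub>zf e\<^sub>0 + (\<partial>\<^sub>vf e\<^sub>1 + \<partial>\<^sub>wf e\<^sub>-\<^sub>1) / sqrt 2\<close>.\<close>
definition solid_grad :: "nat \<Rightarrow> int \<Rightarrow> real ^ 3 \<Rightarrow> complex ^ 3" where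
  "solid_grad n \<mu> x = sph_vec (solid_pred n \<mu> (coord_z x) (coord_v x) (coord_w x))
     (solid_pred n (\<mu> - 1) (coord_z x) (coord_v x) (coord_w x) / sqrt 2)
     (solid_pred n (\<mu> + 1) (coord_z x) (coord_v x) (coord_w x) / sqrt 2)"

lemma solid_at_scaleR: "solid_at n \<mu> (c *\<^sub>R x) = of_real c ^ n * solid_at n \<mu> x"
  by (simp add: solid_at_def coords_scaleR solid_homogeneous)

lemma sph_harm_sgn:
  assumes "x \<noteq> 0"
  shows "sph_harm n \<mu> (sgn x) = of_real (sph_norm n \<mu>) * solid_at n \<mu> x / of_real (norm x ^ n)"
proof -
  have "norm (sgn x) = 1" using assms by (simp add: norm_sgn)
  then have "sph_harm n \<mu> (sgn x) = of_real (sph_norm n \<mu>) * solid_at n \<mu> (sgn x)"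
    by (rule sph_harm_eq)
  moreover have "solid_at n \<mu> (sgn x) = of_real (inverse (norm x)) ^ n * solid_at n \<mu> x"
    unfolding sgn_div_norm by (rule solid_at_scaleR)
  ultimately show ?thesis by (simp add: field_simps)
qed

lemma has_derivative_coords:
  "(coord_z has_derivative coord_z) (at x)" "(coord_v has_derivative coord_v) (at x)" "(coord_w has_derivative coord_w) (at x)"
  by (rule bounded_linear_imp_has_derivative linear_conv_bounded_linear [THEN iffD1] linearI coords_add
      | simp add: coords_scaleR scaleR_conv_of_real [where 'a = complex])+

text \<open>
  Off the origin the extension of \<open>Y\<close> that is constant along rays is \<open>solid_at n \<mu> x / |x| ^ n\<close> up to a
  constant. In particular it is differentiable at the poles too, where longitude is not.
\<close>
lemma has_derivative_sph_harm_sgn: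
  assumes "norm u = 1"
  shows "((\<lambda>x. sph_harm n \<mu> (sgn x)) has_derivative
     (\<lambda>h. of_real (sph_norm n \<mu>) * (solid_pred n \<mu> (coord_z u) (coord_v u) (coord_w u) * coord_z h
        + solid_pred n (\<mu> - 1) (coord_z u) (coord_v u) (coord_w u) * coord_v h
        + solid_pred n (\<mu> + 1) (coord_z u) (coord_v u) (coord_w u) * coord_w h
        - of_nat n * of_real (u \<bullet> h) * solid_at n \<mu> u))) (at u)"
proof -
  have u0: "u \<noteq> 0" using assms by auto
  have 1: "((\<lambda>x. norm x powr (- real n)) has_derivative (\<lambda>h. - real n * (u \<bullet> h))) (at u)"
    by (rule has_derivative_eq_rhs, rule has_derivative_powr[OF has_derivative_norm[OF u0] has_derivative_const])
       (simp_all add: u0 assms fun_eq_iff sgn_div_norm inner_commute)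
  have 2: "((\<lambda>x. of_real (sph_norm n \<mu>) * (solid_at n \<mu> x * of_real (norm x powr (- real n)))) has_derivative
     (\<lambda>h. of_real (sph_norm n \<mu>) * (solid_pred n \<mu> (coord_z u) (coord_v u) (coord_w u) * coord_z h
        + solid_pred n (\<mu> - 1) (coord_z u) (coord_v u) (coord_w u) * coord_v h
        + solid_pred n (\<mu> + 1) (coord_z u) (coord_v u) (coord_w u) * coord_w h
        - of_nat n * of_real (u \<bullet> h) * solid_at n \<mu> u))) (at u)"
    unfolding solid_at_def
    by (rule has_derivative_eq_rhs[OF has_derivative_mult_right[OF has_derivative_mult[OF
          has_derivative_solid[OF has_derivative_coords] has_derivative_of_real[OF 1]]]])
       (simp add: fun_eq_iff assms algebra_simps)
  have 3: "of_real (sph_norm n \<mu>) * (solid_at n \<mu> x * of_real (norm x powr (- real n))) = sph_harm n \<mu> (sgn x)"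
    if "x \<in> - {0}" for x
    using that by (simp add: sph_harm_sgn powr_minus powr_realpow field_simps)
  have "open (- {0 :: real ^ 3})" "u \<in> - {0}" using u0 by auto
  then show ?thesis
    by (rule has_derivative_transform_within_open[OF 2 _ _ 3])
qed

lemma cvec_nth [simp]: "cvec u $ i = of_real (u $ i)"
  by (simp add: cvec_def)

lemma surf_grad_sph_harm:
  assumes "norm u = 1"
  shows "surf_grad (sph_harm n \<mu>) u
     = of_real (sph_norm n \<mu>) *s (solid_grad n \<mu> u - (of_nat n * solid_at n \<mu> u) *s cvec u)"
proof -
  have ax: "coord_z (axis i 1) = (if i = 3 then 1 else 0)"
    "coord_v (axis i 1) = (if i = 1 then - 1 / 2 else if i = 2 then - \<i> / 2 else 0)"
    "coord_w (axis i 1) = (if i = 1 then 1 / 2 else if i = 2 then - \<i> / 2 else 0)" for i :: 3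
    using exhaust_3[of i] by (auto simp: coord_z_def coord_v_def coord_w_def axis_def complex_eq_iff)
  have "surf_grad (sph_harm n \<mu>) u $ i
     = (of_real (sph_norm n \<mu>) *s (solid_grad n \<mu> u - (of_nat n * solid_at n \<mu> u) *s cvec u)) $ i" for i
    using exhaust_3[of i]
    by (auto simp: surf_grad_def frechet_derivative_at[OF has_derivative_sph_harm_sgn[OF assms], symmetric]
        ax inner_axis solid_grad_def field_simps sqrt2_left sqrt2_sq)
  then show ?thesis by (simp add: vec_eq_iff)
qed

text \<open>
  The radial part of \<open>W\<close> restores the radial derivative of a homogeneous function of degree \<open>n\<close>, which
  makes \<open>W\<close> the full gradient of the regular solid harmonic.
\<close>
lemma vsh_W_eq:
  assumes "norm u = 1"
  shows "vsh_W n (sph_harm n \<mu>) u = of_real (sph_norm n \<mu>) *s solid_grad n \<mu> u"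
  by (simp add: vsh_W_def surf_grad_sph_harm[OF assms] sph_harm_eq[OF assms] vec_eq_iff algebra_simps)

text \<open>
  Similarly \<open>V\<close> is the full gradient of \<open>solid_at n \<mu> x / |x| ^ (2 n + 1)\<close>, so the three-term
  relations give its components.
\<close>
lemma vsh_V_eq:
  assumes "norm u = 1"
  shows "vsh_V n (sph_harm n \<mu>) u = of_real (sph_norm n \<mu>) *s sph_vec
     (- ((of_nat n + 1 - of_int \<mu>) * (of_nat n + 1 + of_int \<mu>) * solid_at (Suc n) \<mu> u))
     ((of_nat n - of_int \<mu> + 2) * (of_nat n - of_int \<mu> + 1) * solid_at (Suc n) (\<mu> - 1) u / sqrt 2)
     ((of_nat n + of_int \<mu> + 2) * (of_nat n + of_int \<mu> + 1) * solid_at (Suc n) (\<mu> + 1) u / sqrt 2)"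
proof -
  have "vsh_V n (sph_harm n \<mu>) u
     = of_real (sph_norm n \<mu>) *s (solid_grad n \<mu> u + (- (2 * of_nat n + 1) * solid_at n \<mu> u) *s cvec u)"
    by (simp add: vsh_V_def surf_grad_sph_harm[OF assms] sph_harm_eq[OF assms] vec_eq_iff algebra_simps)
  also have "solid_grad n \<mu> u + (- (2 * of_nat n + 1) * solid_at n \<mu> u) *s cvec u = sph_vec
     (- ((of_nat n + 1 - of_int \<mu>) * (of_nat n + 1 + of_int \<mu>) * solid_at (Suc n) \<mu> u))
     ((of_nat n - of_int \<mu> + 2) * (of_nat n - of_int \<mu> + 1) * solid_at (Suc n) (\<mu> - 1) u / sqrt 2)
     ((of_nat n + of_int \<mu> + 2) * (of_nat n + of_int \<mu> + 1) * solid_at (Suc n) (\<mu> + 1) u / sqrt 2)"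
    unfolding solid_at_def solid_grad_def solid_three_term solid_three_term_minus solid_three_term_plus
      coords_norm assms cvec_sph_vec sph_vec_linear
    by (rule arg_cong3[where f = sph_vec]) (simp_all add: field_simps sqrt2_left)
  finally show ?thesis .
qed

text \<open>
  The operator \<open>r \<times> \<nabla>\<close> is \<open>i\<close> times angular momentum: \<open>L\<^sub>z\<close> preserves the order and the ladder operators
  change it by one, all within degree \<open>n\<close>.
\<close>
lemma vsh_X_eq:
  assumes "norm u = 1"
  shows "vsh_X n (sph_harm n \<mu>) u = (\<i> * of_real (sph_norm n \<mu>)) *s sph_vec
     (of_int \<mu> * solid_at n \<mu> u)
     (- ((of_nat n - of_int \<mu> + 1) * solid_at n (\<mu> - 1) u / sqrt 2))
     ((of_nat n + of_int \<mu> + 1) * solid_at n (\<mu> + 1) u / sqrt 2)"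
proof -
  define z v w where "z = coord_z u" "v = coord_v u" "w = coord_w u"
  define P Pm Pp where "P = solid_pred n \<mu> z v w" "Pm = solid_pred n (\<mu> - 1) z v w" "Pp = solid_pred n (\<mu> + 1) z v w"
  have u: "of_real (u $ 1) = w - v" "of_real (u $ 2) = \<i> * (w + v)" "of_real (u $ 3) = z"
    by (simp_all add: z_v_w_def coord_z_def coord_v_def coord_w_def complex_eq_iff)
  have r: "(of_nat n + of_int \<mu> + 1) * solid_at n (\<mu> + 1) u = z * Pp + 2 * v * P"
    using solid_raise[of n "\<mu> + 1" z v w] by (simp add: P_Pm_Pp_def z_v_w_def solid_at_def add_ac)
  have l: "(of_nat n - of_int \<mu> + 1) * solid_at n (\<mu> - 1) u = z * Pm + 2 * w * P"
    using solid_lower[of n "\<mu> - 1" z v w] by (simp add: P_Pm_Pp_def z_v_w_def solid_at_def algebra_simps)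
  have m: "of_int \<mu> * solid_at n \<mu> u = v * Pm - w * Pp"
    using solid_weight[of \<mu> n z v w] by (simp add: P_Pm_Pp_def z_v_w_def solid_at_def)
  have g: "solid_grad n \<mu> u = sph_vec P (Pm / sqrt 2) (Pp / sqrt 2)"
    by (simp add: solid_grad_def P_Pm_Pp_def z_v_w_def)
  have c: "vsh_X n (sph_harm n \<mu>) u = of_real (sph_norm n \<mu>) *s ccross (cvec u) (solid_grad n \<mu> u)"
    by (simp add: vsh_X_def ccross_def surf_grad_sph_harm[OF assms] vec_eq_iff forall_3 algebra_simps)
  show ?thesis
    unfolding c r l m g
    by (simp add: ccross_def vec_eq_iff forall_3 u field_simps sqrt2_left)
qed

text \<open>The coefficients of \<open>f m\<close> and \<open>f (- m)\<close> in \<open>real_order f m\<close>.\<close>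
definition real_order_coeff :: "int \<Rightarrow> complex \<times> complex" where
  "real_order_coeff m =
     (if m > 0 then ((-1) powi m / sqrt 2, 1 / sqrt 2)
      else if m = 0 then (1, 0)
      else (\<i> / sqrt 2, - (\<i> / sqrt 2 * (-1) powi m)))"

lemma real_order_linear:
  "real_order f m = fst (real_order_coeff m) * f m + snd (real_order_coeff m) * f (- m)"
  by (simp add: real_order_def real_order_coeff_def add_divide_distrib algebra_simps)

lemma surf_grad_linear:
  assumes "(\<lambda>x. f (sgn x)) differentiable (at u)" "(\<lambda>x. g (sgn x)) differentiable (at u)"
  shows "surf_grad (\<lambda>x. a * f x + b * g x) u = a *s surf_grad f u + b *s surf_grad g u"
proof -
  from assms obtain f' g' where d: "((\<lambda>x. f (sgn x)) has_derivative f') (at u)"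
    "((\<lambda>x. g (sgn x)) has_derivative g') (at u)"
    by (auto simp: differentiable_def)
  then have "((\<lambda>x. a * f (sgn x) + b * g (sgn x)) has_derivative (\<lambda>h. a * f' h + b * g' h)) (at u)"
    by (intro has_derivative_add has_derivative_mult_right)
  with d show ?thesis
    by (simp add: surf_grad_def frechet_derivative_at[symmetric] vec_eq_iff)
qed

lemma vsh_linear:
  assumes "Z \<in> {vsh_V, vsh_W, vsh_X}"
    "(\<lambda>x. f (sgn x)) differentiable (at u)" "(\<lambda>x. g (sgn x)) differentiable (at u)"
  shows "Z n (\<lambda>x. a * f x + b * g x) u = a *s Z n f u + b *s Z n g u"
  using assms(1)
  by (auto simp: vsh_V_def vsh_W_def vsh_X_def ccross_def surf_grad_linear[OF assms(2,3)] vec_eq_iff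
      forall_3 algebra_simps)

lemma vsh_real_sph_harm:
  assumes "Z \<in> {vsh_V, vsh_W, vsh_X}" "norm u = 1"
  shows "Z n (real_sph_harm n m) u
     = fst (real_order_coeff m) *s Z n (sph_harm n m) u + snd (real_order_coeff m) *s Z n (sph_harm n (- m)) u"
proof -
  have d: "(\<lambda>x. sph_harm n m (sgn x)) differentiable (at u)" for m
    using has_derivative_sph_harm_sgn[OF assms(2)] by (auto simp: differentiable_def)
  have "real_sph_harm n m = (\<lambda>x. fst (real_order_coeff m) * sph_harm n m x
      + snd (real_order_coeff m) * sph_harm n (- m) x)"
    by (simp add: fun_eq_iff real_sph_harm_def real_order_linear)
  then show ?thesis using vsh_linear[OF assms(1) d d] by simp
qed

text \<open>Inverting the real combinations is legitimate inside \<open>V\<close>, \<open>W\<close>, \<open>X\<close> by linearity.\<close>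
theorem vsh_complex_from_real:
  assumes "Z \<in> {vsh_V, vsh_W, vsh_X}" "norm u = 1"
  shows "Z n (sph_harm n \<mu>) u =
          (if \<mu> > 0 then
             ((-1) powi \<mu> / complex_of_real (sqrt 2))
             *s (Z n (real_sph_harm n \<mu>) u + \<i> *s Z n (real_sph_harm n (- \<mu>)) u)
           else if \<mu> = 0 then Z n (real_sph_harm n 0) u
           else
             (1 / complex_of_real (sqrt 2))
             *s (Z n (real_sph_harm n (- \<mu>)) u - \<i> *s Z n (real_sph_harm n \<mu>) u))"
proof -
  have pm: "(-1 :: complex) powi \<mu> * (-1) powi \<mu> = 1"
    by (simp add: power_int_mult_distrib [symmetric])
  show ?thesis
    unfolding vsh_real_sph_harm[OF assms] real_order_coeff_def
    using pm by (auto simp: vec_eq_iff power_int_minus field_simps sqrt2_left)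
qed

section \<open>Clebsch--Gordan coefficients with a unit spin\<close>

text \<open>The alternating sum of Racah's formula for \<open>\<langle>k, m; 1, q | j, m + q\<rangle>\<close>.\<close>
definition racah_sum :: "nat \<Rightarrow> int \<Rightarrow> int \<Rightarrow> nat \<Rightarrow> real" where
  "racah_sum k m q j = (\<Sum>s | 0 \<le> s \<and> s \<le> int k + 1 - int j \<and> s \<le> int k - m \<and> s \<le> 1 + q
                  \<and> 0 \<le> int j - 1 + m + s \<and> 0 \<le> int j - int k - q + s.
             (-1) powi s / (fact (nat s) * fact (nat (int k + 1 - int j - s)) * fact (nat (int k - m - s))
                            * fact (nat (1 + q - s))
                            * fact (nat (int j - 1 + m + s)) * fact (nat (int j - int k - q + s))))"

lemma cg_one:
  assumes "\<bar>m\<bar> \<le> int k" "\<bar>q\<bar> \<le> 1" "\<bar>m + q\<bar> \<le> int j" "\<bar>int k - 1\<bar> \<le> int j" "j \<le> k + 1"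
  shows "clebsch_gordan (int k) m 1 q (int j) (m + q)
    = sqrt ((2 * real j + 1) * fact (j + k - 1) * fact (j + 1 - k) * fact (k + 1 - j) / fact (j + k + 2))
      * sqrt (solid_norm2 j (m + q) * solid_norm2 k m * solid_norm2 1 q) * racah_sum k m q j"
proof -
  have "nat (int j + int k - 1) = j + k - 1" "nat (int j - int k + 1) = j + 1 - k"
    "nat (int k + 1 - int j) = k + 1 - j" "nat (int k + 1 + int j + 1) = j + k + 2"
    by auto
  then show ?thesis
    using assms unfolding clebsch_gordan_def racah_sum_def Let_def solid_norm2_def
    by (simp add: mult_ac)
qed

text \<open>
  With a spin \<open>1\<close> the constraints leave few values of \<open>s\<close>: only \<open>0\<close> for \<open>j = k + 1\<close> and only \<open>1 + q\<close>
  for \<open>j = k - 1\<close>. For \<open>j = k\<close> both \<open>0\<close> and \<open>1\<close> can occur, but only when \<open>q = 0\<close>.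
\<close>
lemma racah_sum_up:
  assumes "\<bar>m\<bar> \<le> int k" "\<bar>q\<bar> \<le> 1"
  shows "racah_sum k m q (Suc k) = 1 / (solid_norm2 k m * solid_norm2 1 q)"
proof -
  have "{s. 0 \<le> s \<and> s \<le> int k + 1 - int (Suc k) \<and> s \<le> int k - m \<and> s \<le> 1 + q
                  \<and> 0 \<le> int (Suc k) - 1 + m + s \<and> 0 \<le> int (Suc k) - int k - q + s} = {0}"
    using assms by auto
  then show ?thesis by (simp add: racah_sum_def solid_norm2_def mult_ac)
qed

lemma racah_sum_down:
  assumes "\<bar>m\<bar> \<le> int (Suc k)" "\<bar>q\<bar> \<le> 1" "\<bar>m + q\<bar> \<le> int k"
  shows "racah_sum (Suc k) m q k = (-1) powi (1 + q) / (solid_norm2 k (m + q) * solid_norm2 1 q)"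
proof -
  have "{s. 0 \<le> s \<and> s \<le> int (Suc k) + 1 - int k \<and> s \<le> int (Suc k) - m \<and> s \<le> 1 + q
                  \<and> 0 \<le> int k - 1 + m + s \<and> 0 \<le> int k - int (Suc k) - q + s} = {1 + q}"
    using assms by auto
  then show ?thesis by (simp add: racah_sum_def solid_norm2_def mult_ac algebra_simps)
qed

lemma fact_nat_pred: "x > 0 \<Longrightarrow> (fact (nat x) :: real) = of_int x * fact (nat (x - 1))"
  using fact_nat_Suc[of "x - 1"] by simp

lemma racah_sum_same:
  assumes "\<bar>m\<bar> \<le> int k" "\<bar>q\<bar> \<le> 1" "\<bar>m + q\<bar> \<le> int k" "k > 0"
  shows "racah_sum k m q k = (if q = 1 then - (real k - m) else if q = 0 then 2 * real_of_int m else real k + m)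
     / solid_norm2 k m"
proof -
  consider "q = 1" | "q = 0" | "q = -1" using assms(2) by linarith
  then show ?thesis
  proof cases
    case 1
    have "{s. 0 \<le> s \<and> s \<le> int k + 1 - int k \<and> s \<le> int k - m \<and> s \<le> 1 + q
                  \<and> 0 \<le> int k - 1 + m + s \<and> 0 \<le> int k - int k - q + s} = {1}"
      using assms 1 by auto
    moreover have "(fact (nat (int k - m)) :: real) = (real k - m) * fact (nat (int k - m - 1))"
      using fact_nat_pred[of "int k - m"] assms 1 by auto
    ultimately show ?thesis using assms 1 by (simp add: racah_sum_def solid_norm2_def field_simps)
  next
    case 3
    have "{s. 0 \<le> s \<and> s \<le> int k + 1 - int k \<and> s \<le> int k - m \<and> s \<le> 1 + q
                  \<and> 0 \<le> int k - 1 + m + s \<and> 0 \<le> int k - int k - q + s} = {0}"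
      using assms 3 by auto
    moreover have "(fact (nat (int k + m)) :: real) = (real k + m) * fact (nat (int k - 1 + m))"
      using fact_nat_pred[of "int k + m"] assms 3 by (auto simp: algebra_simps)
    moreover have "real k + m \<noteq> 0" using assms 3 by linarith
    ultimately show ?thesis using assms 3 by (simp add: racah_sum_def solid_norm2_def)
  next
    case 2
    have "racah_sum k m q k = (\<Sum>s\<in>{0, 1 :: int}. if s = 0 then (real k + m) / solid_norm2 k m
        else - (real k - m) / solid_norm2 k m)"
      unfolding racah_sum_def
    proof (rule sum.mono_neutral_cong_left, goal_cases)
      case 3
      show ?case
      proof (rule ballI, goal_cases)
        case (1 s)
        then have "s = 0 \<and> m = - int k \<or> s = 1 \<and> m = int k" using 2 assms by auto
        then show ?case by auto
      qed
    next
      case (4 s)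
      then consider "s = 0" "m > - int k" | "s = 1" "m < int k" using 2 by fastforce
      then show ?case
      proof cases
        case 1
        have "(fact (nat (int k + m)) :: real) = (real k + m) * fact (nat (int k - 1 + m))"
          using fact_nat_pred[of "int k + m"] 1 by (auto simp: algebra_simps)
        moreover have "real k + m \<noteq> 0" using 1 by linarith
        ultimately show ?thesis using 1 2 by (simp add: solid_norm2_def)
      next
        case [simp]: 2
        have "(fact (nat (int k - m)) :: real) = (real k - m) * fact (nat (int k - m - 1))"
          using fact_nat_pred[of "int k - m"] 2 by auto
        moreover have "real k - m \<noteq> 0" using 2 by linarith
        ultimately show ?thesis using \<open>q = 0\<close>
          by (simp add: solid_norm2_def add.commute del: minus_diff_eq)
      qed
    qed (use 2 in auto)
    then show ?thesis using 2 by (simp add: field_simps)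
  qed
qed

lemma sqrt_cancel:
  fixes J K Q C :: real
  assumes "J > 0" "K > 0" "Q > 0" "C > 0"
  shows "sqrt (1 / C) * sqrt (J * K * Q) * (e / (K * Q)) = e * sqrt J / (sqrt (C * Q) * sqrt K)"
proof -
  define c j k q where "c = sqrt C" "j = sqrt J" "k = sqrt K" "q = sqrt Q"
  have "K = k * k" "Q = q * q" "k > 0" "q > 0" "c > 0"
    using assms by (simp_all add: c_j_k_q_def)
  moreover have "sqrt (1 / C) * sqrt (J * K * Q) * (e / (K * Q)) = 1 / c * (j * k * q) * (e / (K * Q))"
    by (simp add: c_j_k_q_def real_sqrt_mult real_sqrt_divide)
  ultimately show ?thesis
    by (simp add: c_j_k_q_def[symmetric] real_sqrt_mult mult_ac)
qed

lemma sqrt_cancel':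
  fixes J K Q C :: real
  assumes "K > 0"
  shows "1 / C * sqrt (J * K * Q) * (e / K) = e * sqrt Q * sqrt J / (C * sqrt K)"
proof -
  define j k q where "j = sqrt J" "k = sqrt K" "q = sqrt Q"
  have "K = k * k" "k > 0" using assms by (simp_all add: j_k_q_def)
  moreover have "1 / C * sqrt (J * K * Q) * (e / K) = 1 / C * (j * k * q) * (e / K)"
    by (simp add: j_k_q_def real_sqrt_mult)
  ultimately show ?thesis by (simp add: j_k_q_def[symmetric] mult_ac)
qed

text \<open>
  The next three lemmas are the usual table of Clebsch--Gordan coefficients for a spin \<open>1\<close>. Leaving
  the dependence on the orders in \<open>solid_norm2\<close> lets it cancel against the normalisation of the
  spherical harmonics.
\<close>
lemma cg_up:
  assumes "\<bar>m\<bar> \<le> int k" "\<bar>q\<bar> \<le> 1"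
  shows "clebsch_gordan (int k) m 1 q (int (Suc k)) (m + q)
     = sqrt (solid_norm2 (Suc k) (m + q)) /
       (sqrt ((real k + 1) * (2 * real k + 1) * solid_norm2 1 q) * sqrt (solid_norm2 k m))"
proof -
  have "(2 * real (Suc k) + 1) * fact (Suc k + k - 1) * fact (Suc k + 1 - k) * fact (k + 1 - Suc k) / fact (Suc k + k + 2)
      = 1 / ((real k + 1) * (2 * real k + 1))"
    by (simp add: numeral_2_eq_2 divide_simps) (simp add: algebra_simps)
  then have "clebsch_gordan (int k) m 1 q (int (Suc k)) (m + q)
     = sqrt (1 / ((real k + 1) * (2 * real k + 1))) * sqrt (solid_norm2 (Suc k) (m + q) * solid_norm2 k m * solid_norm2 1 q)
        * (1 / (solid_norm2 k m * solid_norm2 1 q))"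
    using assms by (subst cg_one) (auto simp only: racah_sum_up)
  also have "\<dots> = 1 * sqrt (solid_norm2 (Suc k) (m + q)) /
       (sqrt ((real k + 1) * (2 * real k + 1) * solid_norm2 1 q) * sqrt (solid_norm2 k m))"
    by (rule sqrt_cancel) auto
  finally show ?thesis by simp
qed

lemma cg_down:
  assumes "\<bar>m\<bar> \<le> int (Suc k)" "\<bar>q\<bar> \<le> 1" "\<bar>m + q\<bar> \<le> int k"
  shows "clebsch_gordan (int (Suc k)) m 1 q (int k) (m + q)
     = (-1) powi (1 + q) * sqrt (solid_norm2 (Suc k) m) /
       (sqrt ((real k + 1) * (2 * real k + 3) * solid_norm2 1 q) * sqrt (solid_norm2 k (m + q)))"
proof -
  have "(2 * real k + 1) * fact (k + Suc k - 1) * fact (k + 1 - Suc k) * fact (Suc k + 1 - k) / fact (k + Suc k + 2)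
      = 1 / ((real k + 1) * (2 * real k + 3))"
    by (simp add: numeral_2_eq_2 divide_simps) (simp add: algebra_simps)
  then have "clebsch_gordan (int (Suc k)) m 1 q (int k) (m + q)
     = sqrt (1 / ((real k + 1) * (2 * real k + 3))) * sqrt (solid_norm2 (Suc k) m * solid_norm2 k (m + q) * solid_norm2 1 q)
        * ((-1) powi (1 + q) / (solid_norm2 k (m + q) * solid_norm2 1 q))"
    using assms by (subst cg_one) (auto simp only: racah_sum_down mult.commute [of "solid_norm2 k (m + q)"])
  also have "\<dots> = (-1) powi (1 + q) * sqrt (solid_norm2 (Suc k) m) /
       (sqrt ((real k + 1) * (2 * real k + 3) * solid_norm2 1 q) * sqrt (solid_norm2 k (m + q)))"
    by (rule sqrt_cancel) auto
  finally show ?thesis .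
qed

lemma cg_same:
  assumes "\<bar>m\<bar> \<le> int k" "\<bar>q\<bar> \<le> 1" "\<bar>m + q\<bar> \<le> int k" "k > 0"
  shows "clebsch_gordan (int k) m 1 q (int k) (m + q)
     = (if q = 1 then - (real k - m) else if q = 0 then 2 * real_of_int m else real k + m) *
       sqrt (solid_norm2 1 q) * sqrt (solid_norm2 k (m + q)) / (2 * sqrt (real k * (real k + 1)) * sqrt (solid_norm2 k m))"
proof -
  have "fact (k + k) = 2 * real k * fact (k + k - 1)"
    using assms(4) by (simp add: fact_reduce)
  then have "(2 * real k + 1) * fact (k + k - 1) * fact (k + 1 - k) * fact (k + 1 - k) / fact (k + k + 2)
      = 1 / (2\<^sup>2 * (real k * (real k + 1)))"
    using assms(4) by (simp add: numeral_2_eq_2 divide_simps) (simp add: algebra_simps)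
  then have "sqrt ((2 * real k + 1) * fact (k + k - 1) * fact (k + 1 - k) * fact (k + 1 - k) / fact (k + k + 2))
      = 1 / (2 * sqrt (real k * (real k + 1)))"
    by (simp add: real_sqrt_mult real_sqrt_divide)
  then have "clebsch_gordan (int k) m 1 q (int k) (m + q) = 1 / (2 * sqrt (real k * (real k + 1)))
     * sqrt (solid_norm2 k (m + q) * solid_norm2 k m * solid_norm2 1 q)
     * ((if q = 1 then - (real k - m) else if q = 0 then 2 * real_of_int m else real k + m) / solid_norm2 k m)"
    using assms by (subst cg_one) (auto simp only: racah_sum_same)
  also note sqrt_cancel'
  finally show ?thesis by simp
qed

lemma cg_out_of_range: "\<bar>m\<bar> > j \<Longrightarrow> clebsch_gordan j1 m1 j2 m2 j m = 0"
  by (simp add: clebsch_gordan_def)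

lemma cg_out_of_range_left: "\<bar>m1\<bar> > j1 \<Longrightarrow> clebsch_gordan j1 m1 j2 m2 j m = 0"
  by (simp add: clebsch_gordan_def)

text \<open>The reflection \<open>s \<mapsto> j1 + j2 - j - s\<close> of the summation index exchanges the two spins.\<close>
lemma cg_swap:
  "clebsch_gordan j2 m2 j1 m1 j m = (-1) powi (j1 + j2 - j) * clebsch_gordan j1 m1 j2 m2 j m"
proof (cases "\<bar>m1\<bar> \<le> j1 \<and> \<bar>m2\<bar> \<le> j2 \<and> \<bar>m\<bar> \<le> j \<and> m = m1 + m2 \<and> \<bar>j1 - j2\<bar> \<le> j \<and> j \<le> j1 + j2")
  case True
  then have c: "\<bar>m2\<bar> \<le> j2 \<and> \<bar>m1\<bar> \<le> j1 \<and> \<bar>m\<bar> \<le> j \<and> m = m2 + m1 \<and> \<bar>j2 - j1\<bar> \<le> j \<and> j \<le> j2 + j1"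
    by auto
  define fac where "fac i = (fact (nat i) :: real)" for i
  define S where "S j1 m1 j2 m2 = (\<Sum>s | 0 \<le> s \<and> s \<le> j1 + j2 - j \<and> s \<le> j1 - m1 \<and> s \<le> j2 + m2
                  \<and> 0 \<le> j - j2 + m1 + s \<and> 0 \<le> j - j1 - m2 + s.
             (-1) powi s / (fac s * fac (j1 + j2 - j - s) * fac (j1 - m1 - s) * fac (j2 + m2 - s)
                            * fac (j - j2 + m1 + s) * fac (j - j1 - m2 + s)))" for j1 m1 j2 m2
  have S: "S j2 m2 j1 m1 = (-1) powi (j1 + j2 - j) * S j1 m1 j2 m2"
    unfolding S_def sum_distrib_left
  proof (rule sum.reindex_bij_witness[of _ "\<lambda>s. j1 + j2 - j - s" "\<lambda>s. j1 + j2 - j - s"], goal_cases)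
    case (5 s)
    have "(-1 :: real) powi (j1 + j2 - j) * (-1) powi (j1 + j2 - j - s) = (-1) powi (2 * (j1 + j2 - j) - s)"
      by (simp add: power_int_add [symmetric] algebra_simps)
    also have "\<dots> = (-1) powi s"
      unfolding power_int_diff[of "-1 :: real", simplified] power_int_mult
      by (simp add: divide_eq_eq flip: power_int_mult_distrib)
    finally show ?case by (simp add: algebra_simps)
  qed auto
  have p: "of_int (2 * j + 1) * fac (j + j2 - j1) * fac (j - j2 + j1) * fac (j2 + j1 - j) / fac (j2 + j1 + j + 1)
     = of_int (2 * j + 1) * fac (j + j1 - j2) * fac (j - j1 + j2) * fac (j1 + j2 - j) / fac (j1 + j2 + j + 1)"
    by (simp add: algebra_simps)
  have p': "fac (j + m) * fac (j - m) * fac (j2 - m2) * fac (j2 + m2) * fac (j1 - m1) * fac (j1 + m1)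
     = fac (j + m) * fac (j - m) * fac (j1 - m1) * fac (j1 + m1) * fac (j2 - m2) * fac (j2 + m2)"
    by (simp only: mult_ac)
  show ?thesis
    unfolding clebsch_gordan_def Let_def if_P[OF c] if_P[OF True] fac_def[symmetric]
    unfolding S_def[symmetric] S p p' by (simp only: mult_ac)
qed (auto simp: clebsch_gordan_def abs_minus_commute add.commute)

section \<open>Coupling with a unit vector\<close>

definition sph_basis :: "int \<Rightarrow> complex ^ 3" where
  "sph_basis q = sph_vec (if q = 0 then 1 else 0) (if q = 1 then 1 else 0) (if q = -1 then 1 else 0)"

lemma abs_le_1_cases: "\<bar>q\<bar> \<le> 1 \<Longrightarrow> q = -1 \<or> q = 0 \<or> q = (1 :: int)"
  by auto

lemma sum_unit_spin: "(\<Sum>q=-1..(1 :: int). f q) = f (-1) + f 0 + f 1"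
proof -
  have "{-1..(1 :: int)} = {-1, 0, 1}" by auto
  then show ?thesis by (simp add: add_ac)
qed

lemma solid_norm2_1: "solid_norm2 1 0 = 1" "solid_norm2 1 1 = 2" "solid_norm2 1 (-1) = 2"
  by (simp_all add: solid_norm2_def)

lemma sph_norm_sqrt: "sph_norm n \<mu> = sqrt (2 * real n + 1) / sqrt (4 * pi) * sqrt (solid_norm2 n \<mu>)"
  by (simp add: sph_norm_def real_sqrt_mult real_sqrt_divide)

lemma solid_at_eq_0: "\<bar>\<mu>\<bar> > int n \<Longrightarrow> solid_at n \<mu> u = 0"
  by (simp add: solid_at_def solid_eq_0)

lemma sph_harm_eq_0: "\<bar>\<mu>\<bar> > int n \<Longrightarrow> norm u = 1 \<Longrightarrow> sph_harm n \<mu> u = 0"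
  by (simp add: sph_harm_eq solid_at_eq_0)

text \<open>
  In the products of a coefficient with the normalisation of a spherical harmonic, the square roots
  that depend on the orders combine to rational expressions. This one serves \<open>vsh_W_coupling\<close>; the
  other three serve the products of \<open>Y\<close> with basis vectors and coordinates.
\<close>
lemma cg_up_gradient:
  assumes "\<bar>m\<bar> \<le> int k" "\<bar>q\<bar> \<le> 1"
  shows "sqrt ((real k + 1) * (2 * real k + 3)) * clebsch_gordan (int k) m 1 q (int (Suc k)) (m + q) * sph_norm k m
     = sph_norm (Suc k) (m + q) / sqrt (solid_norm2 1 q)"
proof -
  have [simp]: "sqrt (real k + 1) \<noteq> 0" "sqrt (2 * real k + 1) \<noteq> 0" by (auto simp: add_nonneg_eq_0_iff)
  have e: "2 * real (Suc k) + 1 = 2 * real k + 3" by simp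
  show ?thesis
    unfolding cg_up[OF assms] sph_norm_sqrt real_sqrt_mult e by (simp add: field_simps)
qed

lemma cg_up_coupling:
  assumes "\<bar>m\<bar> \<le> int k" "\<bar>q\<bar> \<le> 1"
  shows "clebsch_gordan (int k) m 1 q (int (Suc k)) (m + q) * sph_norm (Suc k) (m + q)
     = sqrt ((real k + 1) * (2 * real k + 3)) * sph_norm k m *
       (solid_norm2 (Suc k) (m + q) / solid_norm2 k m / ((real k + 1) * (2 * real k + 1) * sqrt (solid_norm2 1 q)))"
proof -
  define A B C D E where "A = sqrt (real k + 1)" "B = sqrt (2 * real k + 1)" "C = sqrt (solid_norm2 (Suc k) (m + q))"
    "D = sqrt (solid_norm2 k m)" "E = sqrt (2 * real k + 3)"
  have e: "2 * real (Suc k) + 1 = 2 * real k + 3" by simp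
  have sq: "real k + 1 = A * A" "2 * real k + 1 = B * B" "solid_norm2 (Suc k) (m + q) = C * C" "solid_norm2 k m = D * D"
    by (simp_all add: A_B_C_D_E_def)
  have nz: "A \<noteq> 0" "B \<noteq> 0" "D \<noteq> 0" by (auto simp: A_B_C_D_E_def add_nonneg_eq_0_iff)
  show ?thesis
    unfolding cg_up[OF assms] sph_norm_sqrt real_sqrt_mult e A_B_C_D_E_def[symmetric]
    unfolding sq using nz by (simp add: mult_ac)
qed

lemma cg_down_coupling:
  assumes "\<bar>m\<bar> \<le> int (Suc k)" "\<bar>q\<bar> \<le> 1" "\<bar>m + q\<bar> \<le> int k"
  shows "clebsch_gordan (int (Suc k)) m 1 q (int k) (m + q) * sph_norm k (m + q)
     = sqrt ((real k + 1) * (2 * real k + 1)) * sph_norm (Suc k) m *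
       ((-1) powi (1 + q) / ((real k + 1) * (2 * real k + 3) * sqrt (solid_norm2 1 q)))"
proof -
  define A B D E where "A = sqrt (real k + 1)" "B = sqrt (2 * real k + 1)"
    "D = sqrt (solid_norm2 k (m + q))" "E = sqrt (2 * real k + 3)"
  have e: "2 * real (Suc k) + 1 = 2 * real k + 3" by simp
  have sq: "real k + 1 = A * A" "2 * real k + 3 = E * E"
    by (simp_all add: A_B_D_E_def)
  have nz: "A \<noteq> 0" "E \<noteq> 0" "D \<noteq> 0" by (auto simp: A_B_D_E_def add_nonneg_eq_0_iff)
  show ?thesis
    unfolding cg_down[OF assms] sph_norm_sqrt real_sqrt_mult e A_B_D_E_def[symmetric]
    unfolding sq using nz by (simp add: mult_ac)
qed

lemma solid_norm2_order_Suc: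
  assumes "-int k \<le> m" "m < int k"
  shows "(real k - m) * solid_norm2 k (m + 1) = (real k + m + 1) * solid_norm2 k m"
proof -
  have e: "int k - (m + 1) = int k - m - 1" "int k + (m + 1) = int k + m + 1" by simp_all
  have f: "(fact (nat (int k - m)) :: real) = (real k - m) * fact (nat (int k - m - 1))"
    "(fact (nat (int k + m + 1)) :: real) = (real k + m + 1) * fact (nat (int k + m))"
    using fact_nat_pred[of "int k - m"] fact_nat_Suc[of "int k + m"] assms by auto
  show ?thesis unfolding solid_norm2_def e f by (simp only: mult_ac)
qed

lemma cg_same_coupling:
  assumes "\<bar>m\<bar> \<le> int k" "\<bar>q\<bar> \<le> 1" "\<bar>m + q\<bar> \<le> int k" "k > 0"
  shows "clebsch_gordan (int k) m 1 q (int k) (m + q) * sph_norm k (m + q)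
     = sqrt (real k * (real k + 1)) * sph_norm k m * sqrt (solid_norm2 1 q) *
       (if q = 1 then - (real k + m + 1) else if q = 0 then 2 * real_of_int m else real k - m + 1)
         / (2 * real k * (real k + 1))"
proof -
  define x where "x = (if q = 1 then - (real k - m) else if q = 0 then 2 * real_of_int m else real k + m)"
  define y where "y = (if q = 1 then - (real k + m + 1) else if q = 0 then 2 * real_of_int m else real k - m + 1)"
  have xy: "x * solid_norm2 k (m + q) = y * solid_norm2 k m"
    using abs_le_1_cases[OF assms(2)] solid_norm2_order_Suc[of k m] solid_norm2_order_Suc[of k "m - 1"] assms
    by (auto simp: x_def y_def algebra_simps)
  define A B C D where "A = sqrt (real k)" "B = sqrt (real k + 1)"
    "C = sqrt (solid_norm2 k (m + q))" "D = sqrt (solid_norm2 k m)"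
  have sq: "real k = A * A" "real k + 1 = B * B" "solid_norm2 k (m + q) = C * C" "solid_norm2 k m = D * D"
    by (simp_all add: A_B_C_D_def)
  have nz: "A \<noteq> 0" "B \<noteq> 0" "D \<noteq> 0" using assms(4) by (auto simp: A_B_C_D_def add_nonneg_eq_0_iff)
  have xy': "x * C * C = y * D * D" using xy by (simp add: sq)
  define N where "N = sqrt (2 * real k + 1) / sqrt (4 * pi)"
  define t where "t = sqrt (solid_norm2 1 q)"
  have "clebsch_gordan (int k) m 1 q (int k) (m + q) * sph_norm k (m + q)
     = x * t * C / (2 * (A * B) * D) * (N * C)"
    unfolding cg_same[OF assms] sph_norm_sqrt real_sqrt_mult A_B_C_D_def x_def N_def t_def ..
  also have "\<dots> = (x * C * C) * t * N / (2 * (A * B) * D)" by simp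
  also have "\<dots> = y * D * t * N / (2 * (A * B))" unfolding xy' using nz by simp
  also have "\<dots> = (A * B) * (N * D) * t * y / (2 * (A * A) * (B * B))" using nz by simp
  also have "\<dots> = sqrt (real k * (real k + 1)) * sph_norm k m * t * y / (2 * real k * (real k + 1))"
    unfolding sq(1,2)[symmetric] sph_norm_sqrt N_def[symmetric] A_B_C_D_def(4)[symmetric]
    by (simp add: A_B_C_D_def real_sqrt_mult)
  finally show ?thesis by (simp add: y_def t_def)
qed

lemma smult_of_real_cong:
  "c * d * e = f \<Longrightarrow>
     complex_of_real c *s (of_real d *s (of_real e *s v)) = complex_of_real f *s (v :: complex ^ 3)"
  by (simp only: vector_smult_assoc mult.assoc flip: of_real_mult)

text \<open>
  The contributions of \<open>j = k + 1\<close>, \<open>k - 1\<close> and \<open>k\<close> to \<open>Y\<^sub>k\<^sup>m e\<^sub>q\<close>, by components. All involve the same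
  three harmonics of degree \<open>k\<close>, so their sum reduces to identities between rational functions.
\<close>
lemma coupling_up:
  assumes u: "norm u = 1" and mq: "\<bar>m\<bar> \<le> int k" "\<bar>q\<bar> \<le> 1"
  shows "complex_of_real (clebsch_gordan (int k) m 1 q (int (Suc k)) (m + q)) *s vsh_Y (Suc k) k (m + q) u
    = of_real (sph_norm k m * (solid_norm2 (Suc k) (m + q) / solid_norm2 k m
          / ((real k + 1) * (2 * real k + 1) * sqrt (solid_norm2 1 q)))) *s
      sph_vec (solid_at k (m + q) u) (solid_at k (m + q - 1) u / sqrt 2) (solid_at k (m + q + 1) u / sqrt 2)"
proof -
  have "vsh_Y (Suc k) k (m + q) u = of_real (1 / sqrt ((real k + 1) * (2 * real k + 3))) *s
      (of_real (sph_norm (Suc k) (m + q)) *s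
      sph_vec (solid_at k (m + q) u) (solid_at k (m + q - 1) u / sqrt 2) (solid_at k (m + q + 1) u / sqrt 2))"
    by (simp add: vsh_Y_def vsh_W_eq[OF u] solid_grad_def solid_at_def)
  moreover have "sqrt ((real k + 1) * (2 * real k + 3)) \<noteq> 0"
    by (auto simp: add_nonneg_eq_0_iff)
  ultimately show ?thesis
    using cg_up_coupling[OF mq] by (simp only:, intro smult_of_real_cong) (simp add: divide_eq_eq mult_ac)
qed

text \<open>
  If \<open>m + q\<close> exceeds the degree \<open>k\<close>, the coefficient on the left vanishes, and on the right every
  component has a vanishing factor or a harmonic of too large order.
\<close>
lemma coupling_down:
  assumes u: "norm u = 1" and mq: "\<bar>m\<bar> \<le> int (Suc k)" "\<bar>q\<bar> \<le> 1"
  shows "complex_of_real (clebsch_gordan (int (Suc k)) m 1 q (int k) (m + q)) *s vsh_Y k (Suc k) (m + q) u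
    = of_real (sph_norm (Suc k) m * ((-1) powi (1 + q) / ((real k + 1) * (2 * real k + 3) * sqrt (solid_norm2 1 q)))) *s
      sph_vec
       (- ((of_nat k + 1 - of_int (m + q)) * (of_nat k + 1 + of_int (m + q)) * solid_at (Suc k) (m + q) u))
       ((of_nat k - of_int (m + q) + 2) * (of_nat k - of_int (m + q) + 1) * solid_at (Suc k) (m + q - 1) u / sqrt 2)
       ((of_nat k + of_int (m + q) + 2) * (of_nat k + of_int (m + q) + 1) * solid_at (Suc k) (m + q + 1) u / sqrt 2)"
    (is "_ = _ *s ?V")
proof (cases "\<bar>m + q\<bar> \<le> int k")
  case True
  have e: "real (Suc k) * (2 * real (Suc k) - 1) = (real k + 1) * (2 * real k + 1)" by (simp add: add_ac)
  have "vsh_Y k (Suc k) (m + q) u = of_real (1 / sqrt ((real k + 1) * (2 * real k + 1))) *s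
      (of_real (sph_norm k (m + q)) *s ?V)"
    unfolding vsh_Y_def vsh_V_eq[OF u] e by (simp add: add_ac)
  moreover have "sqrt ((real k + 1) * (2 * real k + 1)) \<noteq> 0"
    by (auto simp: add_nonneg_eq_0_iff)
  ultimately show ?thesis
    using cg_down_coupling[OF mq True] by (simp only:, intro smult_of_real_cong) (simp add: divide_eq_eq mult_ac)
next
  case False
  then have "m + q = int (Suc k) \<or> m + q = int k + 2 \<or> m + q = - int (Suc k) \<or> m + q = - int k - 2"
    using mq by auto
  then have "?V = sph_vec 0 0 0"
    by (elim disjE) (simp_all add: solid_at_eq_0)
  moreover have "sph_vec 0 0 0 = 0" by (simp add: vec_eq_iff forall_3)
  ultimately show ?thesis using False by (simp add: cg_out_of_range)
qed

lemma coupling_same: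
  assumes u: "norm u = 1" and mq: "\<bar>m\<bar> \<le> int k" "\<bar>q\<bar> \<le> 1" "k > 0"
  shows "complex_of_real (clebsch_gordan (int k) m 1 q (int k) (m + q)) *s vsh_Y k k (m + q) u
    = of_real (sph_norm k m * (sqrt (solid_norm2 1 q) *
       (if q = 1 then - (real k + m + 1) else if q = 0 then 2 * real_of_int m else real k - m + 1)
         / (2 * real k * (real k + 1)))) *s
      sph_vec
     (of_int (m + q) * solid_at k (m + q) u)
     (- ((of_nat k - of_int (m + q) + 1) * solid_at k (m + q - 1) u / sqrt 2))
     ((of_nat k + of_int (m + q) + 1) * solid_at k (m + q + 1) u / sqrt 2)" (is "_ = _ *s ?V")
proof (cases "\<bar>m + q\<bar> \<le> int k")
  case True
  have "vsh_Y k k (m + q) u = of_real (1 / sqrt (real k * (real k + 1))) *s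
      (of_real (sph_norm k (m + q)) *s ?V)"
    unfolding vsh_Y_def vsh_X_eq[OF u] by simp
  moreover have "sqrt (real k * (real k + 1)) \<noteq> 0"
    using mq by (auto simp: add_nonneg_eq_0_iff)
  ultimately show ?thesis
    using cg_same_coupling[OF mq(1,2) True mq(3)]
    by (simp only:, intro smult_of_real_cong) (simp add: divide_eq_eq mult_ac)
next
  case False
  then have "m + q = int k + 1 \<or> m + q = - int k - 1"
    using mq by auto
  then have "?V = sph_vec 0 0 0"
    by (elim disjE) (simp_all add: solid_at_eq_0)
  moreover have "sph_vec 0 0 0 = 0" by (simp add: vec_eq_iff forall_3)
  ultimately show ?thesis using False by (simp add: cg_out_of_range)
qed

lemma coupling_degrees:
  "{j. \<bar>int k - 1\<bar> \<le> int j \<and> int j \<le> int k + 1} = (if k = 0 then {1} else {k - 1, k, Suc k})"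
  by auto

lemma solid_norm2_ratio:
  assumes "\<bar>m\<bar> \<le> int k" "\<bar>q\<bar> \<le> 1"
  shows "solid_norm2 (Suc k) (m + q) / solid_norm2 k m
    = (if q = 0 then (real k + 1 - m) * (real k + 1 + m)
       else (real k + 1 + q * m) * (real k + 2 + q * m))"
proof -
  from abs_le_1_cases[OF assms(2)] consider "q = -1" | "q = 0" | "q = 1" by blast
  then show ?thesis
  proof cases
    case 1
    show ?thesis using solid_norm2_Suc(2)[OF assms(1)] by (simp add: 1) (simp add: algebra_simps)
  next
    case 2
    show ?thesis using solid_norm2_Suc(1)[OF assms(1)] by (simp add: 2)
  next
    case 3
    show ?thesis using solid_norm2_Suc(3)[OF assms(1)] by (simp add: 3) (simp add: algebra_simps)
  qed
qed

text \<open>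
  Orthogonality of the Clebsch--Gordan coefficients in the form needed here: the vector spherical
  harmonics of orbital degree \<open>k\<close> recombine to a single scalar harmonic times a basis vector.
\<close>
theorem sph_harm_smult_basis:
  assumes u: "norm u = 1" and mq: "\<bar>m\<bar> \<le> int k" "\<bar>q\<bar> \<le> 1"
  shows "(\<Sum>j | \<bar>int k - 1\<bar> \<le> int j \<and> int j \<le> int k + 1.
       complex_of_real (clebsch_gordan (int k) m 1 q (int j) (m + q)) *s vsh_Y j k (m + q) u)
     = sph_harm k m u *s sph_basis q"
proof (cases k)
  case 0
  then have m: "m = 0" using mq by simp
  have s0: "solid_at 0 \<nu> u = (if \<nu> = 0 then 1 else 0)" for \<nu> by (simp add: solid_at_def)
  have "(\<Sum>j | \<bar>int k - 1\<bar> \<le> int j \<and> int j \<le> int k + 1.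
       complex_of_real (clebsch_gordan (int k) m 1 q (int j) (m + q)) *s vsh_Y j k (m + q) u)
    = complex_of_real (clebsch_gordan (int 0) m 1 q (int (Suc 0)) (m + q)) *s vsh_Y (Suc 0) 0 (m + q) u"
    unfolding 0 coupling_degrees by simp
  also have "\<dots> = sph_harm k m u *s sph_basis q"
    using abs_le_1_cases[OF mq(2)]
    unfolding coupling_up[OF u mq[unfolded 0]] solid_norm2_ratio[OF mq[unfolded 0]] s0 sph_harm_eq[OF u] sph_basis_def
    by (elim disjE; simp add: 0 m s0 solid_norm2_1 sph_vec_linear sqrt2_sq field_simps
          del: One_nat_def)
  finally show ?thesis .
next
  case (Suc K)
  define x y where "x = complex_of_nat k" "y = complex_of_int m"
  have nz: "x \<noteq> 0" "x + 1 \<noteq> 0" "2 * x + 1 \<noteq> 0"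
  proof -
    have e: "2 * x + 1 = of_nat (2 * k + 1)" "x + 1 = of_nat (k + 1)" by (simp_all add: x_y_def)
    show "x \<noteq> 0" unfolding x_y_def of_nat_eq_0_iff by (simp add: Suc)
    show "x + 1 \<noteq> 0" "2 * x + 1 \<noteq> 0" unfolding e of_nat_eq_0_iff by simp_all
  qed
  have nz': "1 + 2 * x \<noteq> 0" using nz by (simp add: add.commute)
  have nz2: "2 + x * 2 \<noteq> 0" "2 + x * 4 \<noteq> 0"
  proof -
    have "2 + x * 2 = 2 * (x + 1)" "2 + x * 4 = 2 * (2 * x + 1)" by simp_all
    then show "2 + x * 2 \<noteq> 0" "2 + x * 4 \<noteq> 0" using nz by (metis mult_eq_0_iff zero_neq_numeral)+
  qed
  have K: "complex_of_nat K = x - 1" "real K = real k - 1" by (simp_all add: x_y_def Suc)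
  have "(\<Sum>j | \<bar>int k - 1\<bar> \<le> int j \<and> int j \<le> int k + 1.
       complex_of_real (clebsch_gordan (int k) m 1 q (int j) (m + q)) *s vsh_Y j k (m + q) u)
     = complex_of_real (clebsch_gordan (int (Suc K)) m 1 q (int K) (m + q)) *s vsh_Y K (Suc K) (m + q) u
     + complex_of_real (clebsch_gordan (int k) m 1 q (int k) (m + q)) *s vsh_Y k k (m + q) u
     + complex_of_real (clebsch_gordan (int k) m 1 q (int (Suc k)) (m + q)) *s vsh_Y (Suc k) k (m + q) u"
    unfolding coupling_degrees by (simp add: Suc add_ac)
  also have "\<dots> = sph_harm k m u *s sph_basis q"
    unfolding coupling_down[OF u mq[unfolded Suc]] coupling_up[OF u mq] coupling_same[OF u mq, unfolded Suc, OF zero_less_Suc, folded Suc]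
    unfolding Suc[symmetric] K sph_vec_linear sph_basis_def solid_norm2_ratio[OF mq] sph_harm_eq[OF u]
    using abs_le_1_cases[OF mq(2)]
    apply (elim disjE; intro arg_cong3[where f = sph_vec])
    apply (simp_all add: solid_norm2_1 sqrt2_sq sqrt2_left del: One_nat_def flip: x_y_def)
    using nz nz'
    by (simp_all add: divide_simps sqrt2_sq sqrt2_left)
      (simp_all add: algebra_simps sqrt2_sq sqrt2_left nz2)
  finally show ?thesis .
qed

text \<open>
  The components of \<open>W\<close> are harmonics of degree one lower (\<open>vsh_W_eq\<close>), with the coefficients of
  the top coupling \<open>j = k + 1\<close>.
\<close>
lemma vsh_W_coupling:
  assumes u: "norm u = 1" and \<mu>: "\<bar>\<mu>\<bar> \<le> int (Suc n)"
  shows "vsh_W (Suc n) (sph_harm (Suc n) \<mu>) u = (\<Sum>q=-1..1.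
     (of_real (sqrt ((real n + 1) * (2 * real n + 3)) * clebsch_gordan (int n) (\<mu> - q) 1 q (int (Suc n)) \<mu>)
        * sph_harm n (\<mu> - q) u) *s sph_basis q)"
proof -
  have c: "of_real (sqrt ((real n + 1) * (2 * real n + 3)) * clebsch_gordan (int n) (\<mu> - q) 1 q (int (Suc n)) \<mu>)
        * sph_harm n (\<mu> - q) u = of_real (sph_norm (Suc n) \<mu> / sqrt (solid_norm2 1 q)) * solid_at n (\<mu> - q) u"
    if q: "\<bar>q\<bar> \<le> 1" for q
  proof (cases "\<bar>\<mu> - q\<bar> \<le> int n")
    case True
    from cg_up_gradient[OF True q] show ?thesis
      unfolding sph_harm_eq[OF u] by (simp only: diff_add_cancel flip: mult.assoc of_real_mult)
  qed (simp add: sph_harm_eq[OF u] solid_at_eq_0)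
  have "vsh_W (Suc n) (sph_harm (Suc n) \<mu>) u = (\<Sum>q=-1..1.
     (of_real (sph_norm (Suc n) \<mu> / sqrt (solid_norm2 1 q)) * solid_at n (\<mu> - q) u) *s sph_basis q)"
    unfolding sum_unit_spin vsh_W_eq[OF u] solid_grad_def sph_basis_def sph_vec_linear solid_norm2_1 solid_at_def
    by simp
  also have "\<dots> = (\<Sum>q=-1..1.
     (of_real (sqrt ((real n + 1) * (2 * real n + 3)) * clebsch_gordan (int n) (\<mu> - q) 1 q (int (Suc n)) \<mu>)
        * sph_harm n (\<mu> - q) u) *s sph_basis q)"
    by (intro sum.cong refl arg_cong2[where f = "(*s)"] c[symmetric]) auto
  finally show ?thesis .
qed

lemma sph_comp_eq:
  "sph_comp x 0 = coord_z x" "sph_comp x 1 = of_real (sqrt 2) * coord_v x" "sph_comp x (-1) = of_real (sqrt 2) * coord_w x"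
  by (simp_all add: sph_comp_def coord_z_def coord_v_def coord_w_def complex_eq_iff field_simps)

lemma sph_comp_inner: "(\<Sum>q=-1..1. (-1) powi q * sph_comp a (- q) * sph_comp u q) = of_real (a \<bullet> u)"
  by (simp add: sum_unit_spin sph_comp_eq sqrt2_left sqrt2_sq mult_ac flip: coords_inner)

lemma sph_comp_cvec: "(\<Sum>q=-1..1. ((-1) powi q * sph_comp a (- q)) *s sph_basis q) = cvec a"
  by (simp add: sum_unit_spin sph_comp_eq sph_basis_def sph_vec_linear cvec_sph_vec)

lemma cg_zero_orders:
  "clebsch_gordan 1 0 (int n) 0 (int (Suc n)) 0 = (real n + 1) / sqrt ((real n + 1) * (2 * real n + 1))"
  "clebsch_gordan 1 0 (int (Suc n)) 0 (int n) 0 = - ((real n + 1) / sqrt ((real n + 1) * (2 * real n + 3)))"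
proof -
  have 1: "sqrt (solid_norm2 (Suc n) 0) = (real n + 1) * sqrt (solid_norm2 n 0)"
    using solid_norm2_Suc(1)[of 0 n] by (simp add: real_sqrt_mult)
  have "sqrt (solid_norm2 n 0) \<noteq> 0" by simp
  with cg_up[of 0 n 0] 1 show
    "clebsch_gordan 1 0 (int n) 0 (int (Suc n)) 0 = (real n + 1) / sqrt ((real n + 1) * (2 * real n + 1))"
    by (subst cg_swap) (simp add: solid_norm2_1[simplified] del: of_nat_Suc)
  from \<open>sqrt (solid_norm2 n 0) \<noteq> 0\<close> cg_down[of 0 n 0] 1 show
    "clebsch_gordan 1 0 (int (Suc n)) 0 (int n) 0 = - ((real n + 1) / sqrt ((real n + 1) * (2 * real n + 3)))"
    by (subst cg_swap) (simp add: solid_norm2_1[simplified] power_int_add)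
qed

text \<open>
  The two degrees that occur in the product of a coordinate and \<open>Y\<close>. Degree \<open>n\<close> itself is absent by
  parity.
\<close>
lemma product_up:
  assumes \<nu>: "\<bar>\<nu>\<bar> \<le> int n" and q: "\<bar>q\<bar> \<le> 1"
  shows "sqrt ((2 * real n + 1) / (2 * real (Suc n) + 1)) * clebsch_gordan 1 q (int n) \<nu> (int (Suc n)) (q + \<nu>)
     * clebsch_gordan 1 0 (int n) 0 (int (Suc n)) 0 * sph_norm (Suc n) (q + \<nu>)
     = sph_norm n \<nu> * (solid_norm2 (Suc n) (\<nu> + q) / solid_norm2 n \<nu>) / ((2 * real n + 1) * sqrt (solid_norm2 1 q))"
proof -
  have s: "clebsch_gordan 1 q (int n) \<nu> (int (Suc n)) (q + \<nu>) = clebsch_gordan (int n) \<nu> 1 q (int (Suc n)) (\<nu> + q)"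
    by (subst cg_swap) (simp add: add_ac)
  define A B E where "A = sqrt (real n + 1)" "B = sqrt (2 * real n + 1)" "E = sqrt (2 * real n + 3)"
  have e: "2 * real (Suc n) + 1 = 2 * real n + 3" by simp
  have sq: "real n + 1 = A * A" "2 * real n + 1 = B * B" by (simp_all add: A_B_E_def)
  have nz: "A \<noteq> 0" "B \<noteq> 0" "E \<noteq> 0" by (auto simp: A_B_E_def add_nonneg_eq_0_iff)
  define X where "X = clebsch_gordan (int n) \<nu> 1 q (int (Suc n)) (\<nu> + q) * sph_norm (Suc n) (\<nu> + q)"
  define R where "R = solid_norm2 (Suc n) (\<nu> + q) / solid_norm2 n \<nu>"
  have "X = A * E * sph_norm n \<nu> * (R / (A * A * (B * B) * sqrt (solid_norm2 1 q)))"
    unfolding X_def cg_up_coupling[OF \<nu> q] real_sqrt_mult A_B_E_def(1,3)[symmetric] R_def[symmetric]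
    unfolding sq ..
  moreover have "sqrt ((2 * real n + 1) / (2 * real (Suc n) + 1)) * clebsch_gordan 1 q (int n) \<nu> (int (Suc n)) (q + \<nu>)
     * clebsch_gordan 1 0 (int n) 0 (int (Suc n)) 0 * sph_norm (Suc n) (q + \<nu>)
     = B / E * (A * A / (A * B)) * X"
    unfolding s cg_zero_orders real_sqrt_divide real_sqrt_mult e A_B_E_def[symmetric] X_def
    unfolding sq by (simp add: add.commute)
  ultimately show ?thesis
    unfolding R_def[symmetric] sq using nz by (simp add: mult_ac)
qed

lemma product_down:
  assumes \<nu>: "\<bar>\<nu>\<bar> \<le> int (Suc n)" and q: "\<bar>q\<bar> \<le> 1" and \<nu>q: "\<bar>\<nu> + q\<bar> \<le> int n"
  shows "sqrt ((2 * real n + 3) / (2 * real n + 1)) * clebsch_gordan 1 q (int (Suc n)) \<nu> (int n) (q + \<nu>)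
     * clebsch_gordan 1 0 (int (Suc n)) 0 (int n) 0 * sph_norm n (q + \<nu>)
     = sph_norm (Suc n) \<nu> * (-1) powi q / ((2 * real n + 3) * sqrt (solid_norm2 1 q))"
proof -
  have s: "clebsch_gordan 1 q (int (Suc n)) \<nu> (int n) (q + \<nu>) = clebsch_gordan (int (Suc n)) \<nu> 1 q (int n) (\<nu> + q)"
    by (subst cg_swap) (simp add: add_ac)
  define A B E where "A = sqrt (real n + 1)" "B = sqrt (2 * real n + 1)" "E = sqrt (2 * real n + 3)"
  have sq: "real n + 1 = A * A" "2 * real n + 3 = E * E" by (simp_all add: A_B_E_def)
  have nz: "A \<noteq> 0" "B \<noteq> 0" "E \<noteq> 0" by (auto simp: A_B_E_def add_nonneg_eq_0_iff)
  define X where "X = clebsch_gordan (int (Suc n)) \<nu> 1 q (int n) (\<nu> + q) * sph_norm n (\<nu> + q)"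
  have "X = A * B * sph_norm (Suc n) \<nu> * ((-1) powi (1 + q) / (A * A * (E * E) * sqrt (solid_norm2 1 q)))"
    unfolding X_def cg_down_coupling[OF \<nu> q \<nu>q] real_sqrt_mult A_B_E_def(1,2)[symmetric]
    unfolding sq ..
  moreover have "sqrt ((2 * real n + 3) / (2 * real n + 1)) * clebsch_gordan 1 q (int (Suc n)) \<nu> (int n) (q + \<nu>)
     * clebsch_gordan 1 0 (int (Suc n)) 0 (int n) 0 * sph_norm n (q + \<nu>)
     = E / B * (- (A * A / (A * E))) * X"
    unfolding s cg_zero_orders real_sqrt_divide real_sqrt_mult A_B_E_def[symmetric] X_def
    unfolding sq by (simp add: add.commute)
  ultimately show ?thesis
    unfolding sq using nz by (simp add: mult_ac power_int_add)
qed

text \<open>The three-term relations once more, read as expansions of \<open>z\<close>, \<open>v\<close> and \<open>w\<close> times a harmonic.\<close>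
lemma solid_mult_coordinate:
  assumes u: "norm u = 1" and \<nu>: "\<bar>\<nu>\<bar> \<le> int n" and q: "\<bar>q\<bar> \<le> 1"
  shows "of_real (solid_norm2 (Suc n) (\<nu> + q) / solid_norm2 n \<nu>) * solid_at (Suc n) (\<nu> + q) u
     + (-1) powi q * solid_pred n (\<nu> + q) (coord_z u) (coord_v u) (coord_w u)
     = of_real ((2 * real n + 1) * sqrt (solid_norm2 1 q)) * sph_comp u q * solid_at n \<nu> u"
proof -
  have c: "(coord_z u)\<^sup>2 - 4 * coord_v u * coord_w u = 1" using coords_norm[of u] u by simp
  note t = solid_three_term[of n \<nu> "coord_z u" "coord_v u" "coord_w u", unfolded c]
    solid_three_term_minus[of n \<nu> "coord_z u" "coord_v u" "coord_w u", unfolded c]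
    solid_three_term_plus[of n \<nu> "coord_z u" "coord_v u" "coord_w u", unfolded c]
  from abs_le_1_cases[OF q] show ?thesis
  proof (elim disjE)
    assume [simp]: "q = -1"
    show ?thesis using t(2) solid_norm2_Suc(2)[OF \<nu>]
      by (simp add: sph_comp_eq solid_norm2_1[simplified] solid_at_def sqrt2_left sqrt2_sq mult_ac del: solid.simps;
        simp add: algebra_simps sqrt2_left)
  next
    assume [simp]: "q = 0"
    show ?thesis using t(1) solid_norm2_Suc(1)[OF \<nu>]
      by (simp add: sph_comp_eq solid_norm2_1[simplified] solid_at_def del: solid.simps)
  next
    assume [simp]: "q = 1"
    show ?thesis using t(3) solid_norm2_Suc(3)[OF \<nu>]
      by (simp add: sph_comp_eq solid_norm2_1[simplified] solid_at_def sqrt2_left sqrt2_sq mult_ac del: solid.simps;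
        simp add: algebra_simps sqrt2_left)
  qed
qed

lemma product_degrees:
  "{k. \<bar>int (Suc n) - 2\<bar> \<le> int k \<and> int k \<le> int (Suc n) \<and> int k \<noteq> int (Suc n) - 1}
     = (if n = 0 then {1} else {n - 1, Suc n})"
  by auto

theorem sph_comp_mult_sph_harm:
  assumes u: "norm u = 1" and q: "\<bar>q\<bar> \<le> 1"
  shows "(\<Sum>k | \<bar>int (Suc n) - 2\<bar> \<le> int k \<and> int k \<le> int (Suc n) \<and> int k \<noteq> int (Suc n) - 1.
      of_real (sqrt ((2 * real n + 1) / (2 * real k + 1)) * clebsch_gordan 1 q (int n) \<nu> (int k) (q + \<nu>)
        * clebsch_gordan 1 0 (int n) 0 (int k) 0) * sph_harm k (q + \<nu>) u)
     = sph_comp u q * sph_harm n \<nu> u"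
proof (cases "\<bar>\<nu>\<bar> \<le> int n")
  case \<nu>: True
  define f where "f = (\<lambda>k. of_real (sqrt ((2 * real n + 1) / (2 * real k + 1)) * clebsch_gordan 1 q (int n) \<nu> (int k) (q + \<nu>)
        * clebsch_gordan 1 0 (int n) 0 (int k) 0) * sph_harm k (q + \<nu>) u)"
  define c where "c = complex_of_real (sph_norm n \<nu> / ((2 * real n + 1) * sqrt (solid_norm2 1 q)))"
  have up: "f (Suc n) = c * (of_real (solid_norm2 (Suc n) (\<nu> + q) / solid_norm2 n \<nu>) * solid_at (Suc n) (\<nu> + q) u)"
  proof -
    have "f (Suc n) = of_real (sqrt ((2 * real n + 1) / (2 * real (Suc n) + 1)) * clebsch_gordan 1 q (int n) \<nu> (int (Suc n)) (q + \<nu>)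
       * clebsch_gordan 1 0 (int n) 0 (int (Suc n)) 0 * sph_norm (Suc n) (q + \<nu>)) * solid_at (Suc n) (q + \<nu>) u"
      unfolding f_def sph_harm_eq[OF u] by (simp only: of_real_mult mult.assoc)
    also note product_up[OF \<nu> q]
    finally show ?thesis by (simp add: c_def add.commute mult_ac)
  qed
  have "(\<Sum>k | \<bar>int (Suc n) - 2\<bar> \<le> int k \<and> int k \<le> int (Suc n) \<and> int k \<noteq> int (Suc n) - 1. f k)
    = c * (of_real (solid_norm2 (Suc n) (\<nu> + q) / solid_norm2 n \<nu>) * solid_at (Suc n) (\<nu> + q) u
     + (-1) powi q * solid_pred n (\<nu> + q) (coord_z u) (coord_v u) (coord_w u))"
  proof (cases n)
    case 0
    have "f 1 = f (Suc n)" by (simp add: 0)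
    then show ?thesis unfolding product_degrees using up by (simp add: 0)
  next
    case (Suc N)
    have "f N = c * ((-1) powi q * solid_at N (\<nu> + q) u)"
    proof (cases "\<bar>\<nu> + q\<bar> \<le> int N")
      case True
      have e: "2 * real n + 1 = 2 * real N + 3" by (simp add: Suc)
      have "f N = of_real (sqrt ((2 * real N + 3) / (2 * real N + 1)) * clebsch_gordan 1 q (int (Suc N)) \<nu> (int N) (q + \<nu>)
         * clebsch_gordan 1 0 (int (Suc N)) 0 (int N) 0 * sph_norm N (q + \<nu>)) * solid_at N (q + \<nu>) u"
        unfolding f_def sph_harm_eq[OF u] e unfolding Suc by (simp only: of_real_mult mult.assoc)
      also note product_down[OF \<nu>[unfolded Suc] q True]
      finally show ?thesis unfolding c_def e by (simp add: Suc add.commute)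
    next
      case False
      then have "\<bar>q + \<nu>\<bar> > int N" by (simp add: add.commute)
      then show ?thesis by (simp add: f_def sph_harm_eq_0[OF _ u] solid_at_eq_0 add.commute)
    qed
    then have "f N = c * ((-1) powi q * solid_pred n (\<nu> + q) (coord_z u) (coord_v u) (coord_w u))"
      by (simp add: Suc solid_at_def)
    then show ?thesis unfolding product_degrees using up by (simp add: Suc algebra_simps)
  qed
  also have "\<dots> = sph_comp u q * sph_harm n \<nu> u"
  proof -
    have "(2 * real n + 1) * sqrt (solid_norm2 1 q) \<noteq> 0" by (auto simp: add_nonneg_eq_0_iff)
    then have "c * of_real ((2 * real n + 1) * sqrt (solid_norm2 1 q)) = of_real (sph_norm n \<nu>)"
      unfolding c_def of_real_mult [symmetric] by simp
    then show ?thesis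
      unfolding solid_mult_coordinate[OF u \<nu> q] sph_harm_eq[OF u] by (simp add: mult_ac)
  qed
  finally show ?thesis by (simp add: f_def)
next
  case False
  then show ?thesis
    by (simp add: sph_harm_eq_0[OF _ u] clebsch_gordan_def)
qed

text \<open>
  The coefficient \<open>K\<close> records four steps: \<open>W\<close> is split into \<open>Y\<^sub>n\<^sub>-\<^sub>1 e\<close> by \<open>vsh_W_coupling\<close>, the scalar
  product into spherical coordinates by \<open>sph_comp_inner\<close>, each coordinate is multiplied into \<open>Y\<^sub>n\<^sub>-\<^sub>1\<close> by
  \<open>sph_comp_mult_sph_harm\<close>, and the result is recombined by \<open>sph_harm_smult_basis\<close>. The proof undoes
  them from the innermost sum outwards.
\<close>
theorem inner_mult_vsh_W:
  assumes u: "norm u = 1" and \<mu>: "\<bar>\<mu>\<bar> \<le> int n" and n: "n > 0"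
  shows "(\<Sum>q=-1..1. \<Sum>m1=-1..1.
        \<Sum>k | \<bar>int n - 2\<bar> \<le> int k \<and> int k \<le> int n \<and> int k \<noteq> int n - 1.
        \<Sum>j | \<bar>int k - 1\<bar> \<le> int j \<and> int j \<le> int k + 1.
        (c * sph_comp a (- q) * h * complex_of_real (K_coeff k j n m1 \<mu> q)) *s vsh_Y j k (q + \<mu>) u)
     = (c * h * of_real (a \<bullet> u)) *s vsh_W n (sph_harm n \<mu>) u"
proof -
  obtain N where N: "n = Suc N" using n by (cases n) auto
  define Ks where "Ks = {k. \<bar>int n - 2\<bar> \<le> int k \<and> int k \<le> int n \<and> int k \<noteq> int n - 1}"
  define C2 where "C2 m1 = sqrt ((real N + 1) * (2 * real N + 3)) * clebsch_gordan (int N) (\<mu> - m1) 1 m1 (int n) \<mu>" for m1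
  define C3 where "C3 q m1 k = sqrt ((2 * real N + 1) / (2 * real k + 1)) * clebsch_gordan 1 q (int N) (\<mu> - m1) (int k) (q + (\<mu> - m1))
        * clebsch_gordan 1 0 (int N) 0 (int k) 0" for q m1 k
  have K: "K_coeff k j n m1 \<mu> q = (-1) powi q * C2 m1 * C3 q m1 k
      * clebsch_gordan (int k) (q + \<mu> - m1) 1 m1 (int j) (q + \<mu>)" for k j m1 q
  proof -
    have e: "real n * (2 * real n + 1) * (2 * real n - 1) / (2 * real k + 1)
        = ((real N + 1) * (2 * real N + 3)) * ((2 * real N + 1) / (2 * real k + 1))" "int n - 1 = int N"
        "q + (\<mu> - m1) = q + \<mu> - m1"
      by (simp_all add: N add_ac)
    show ?thesis unfolding K_coeff_def C2_def C3_def e real_sqrt_mult[of "(real N + 1) * (2 * real N + 3)"] by simp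
  qed
  have J: "(\<Sum>j | \<bar>int k - 1\<bar> \<le> int j \<and> int j \<le> int k + 1.
        complex_of_real (clebsch_gordan (int k) (q + \<mu> - m1) 1 m1 (int j) (q + \<mu>)) *s vsh_Y j k (q + \<mu>) u)
      = sph_harm k (q + \<mu> - m1) u *s sph_basis m1" if "m1 \<in> {-1..1}" for k q m1
  proof (cases "\<bar>q + \<mu> - m1\<bar> \<le> int k")
    case True
    from sph_harm_smult_basis[OF u this, of m1] that show ?thesis by auto
  qed (simp add: cg_out_of_range_left sph_harm_eq_0[OF _ u])
  have S: "(\<Sum>k\<in>Ks. of_real (C3 q m1 k) * sph_harm k (q + \<mu> - m1) u) = sph_comp u q * sph_harm N (\<mu> - m1) u"
    if "q \<in> {-1..1}" for q m1
  proof -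
    have "\<bar>q\<bar> \<le> 1" using that by auto
    from sph_comp_mult_sph_harm[OF u this, of N "\<mu> - m1"] show ?thesis
      unfolding Ks_def C3_def N add_diff_eq .
  qed
  have W: "(\<Sum>m1=-1..1. (of_real (C2 m1) * sph_harm N (\<mu> - m1) u) *s sph_basis m1) = vsh_W n (sph_harm n \<mu>) u"
    using vsh_W_coupling[OF u \<mu>[unfolded N]] unfolding C2_def N by simp
  have "(\<Sum>q=-1..1. \<Sum>m1=-1..1. \<Sum>k\<in>Ks. \<Sum>j | \<bar>int k - 1\<bar> \<le> int j \<and> int j \<le> int k + 1.
        (c * sph_comp a (- q) * h * complex_of_real (K_coeff k j n m1 \<mu> q)) *s vsh_Y j k (q + \<mu>) u)
     = (\<Sum>q=-1..1. \<Sum>m1=-1..1. \<Sum>k\<in>Ks.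
        (c * h * ((-1) powi q * sph_comp a (- q)) * of_real (C2 m1) * of_real (C3 q m1 k)) *s
          (\<Sum>j | \<bar>int k - 1\<bar> \<le> int j \<and> int j \<le> int k + 1.
        complex_of_real (clebsch_gordan (int k) (q + \<mu> - m1) 1 m1 (int j) (q + \<mu>)) *s vsh_Y j k (q + \<mu>) u))"
    unfolding vec.scale_sum_right K by (simp add: mult_ac)
  also have "\<dots> = (\<Sum>q=-1..1. \<Sum>m1=-1..1. \<Sum>k\<in>Ks.
        (c * h * ((-1) powi q * sph_comp a (- q)) * of_real (C2 m1)) *s
          ((of_real (C3 q m1 k) * sph_harm k (q + \<mu> - m1) u) *s sph_basis m1))"
    by (intro sum.cong refl) (simp only: J vector_smult_assoc mult_ac)
  also have "\<dots> = (\<Sum>q=-1..1. \<Sum>m1=-1..1.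
        (c * h * ((-1) powi q * sph_comp a (- q)) * of_real (C2 m1)) *s
          ((\<Sum>k\<in>Ks. of_real (C3 q m1 k) * sph_harm k (q + \<mu> - m1) u) *s sph_basis m1))"
    unfolding vec.scale_sum_left vec.scale_sum_right ..
  also have "\<dots> = (\<Sum>q=-1..1. \<Sum>m1=-1..1.
        (c * h * ((-1) powi q * sph_comp a (- q) * sph_comp u q)) *s
          ((of_real (C2 m1) * sph_harm N (\<mu> - m1) u) *s sph_basis m1))"
    by (intro sum.cong refl) (simp only: S vector_smult_assoc mult_ac)
  also have "\<dots> = (\<Sum>q=-1..1. (c * h * ((-1) powi q * sph_comp a (- q) * sph_comp u q)) *s vsh_W n (sph_harm n \<mu>) u)"
    unfolding vec.scale_sum_right [symmetric] W ..
  also have "\<dots> = (c * h * of_real (a \<bullet> u)) *s vsh_W n (sph_harm n \<mu>) u"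
    unfolding vec.scale_sum_left [symmetric] sum_distrib_left [symmetric] sph_comp_inner ..
  finally show ?thesis unfolding Ks_def .
qed

theorem vec_mult_sph_harm:
  assumes u: "norm u = 1" and \<mu>: "\<bar>\<mu>\<bar> \<le> int n"
  shows "(\<Sum>q=-1..1. \<Sum>j | \<bar>int n - 1\<bar> \<le> int j \<and> int j \<le> int n + 1.
        ((-1) powi q * sph_comp a (- q) * c * h
          * complex_of_real (clebsch_gordan (int n) \<mu> 1 q (int j) (\<mu> + q))) *s vsh_Y j n (q + \<mu>) u)
    = (c * h * sph_harm n \<mu> u) *s cvec a"
proof -
  have "(\<Sum>q=-1..1. \<Sum>j | \<bar>int n - 1\<bar> \<le> int j \<and> int j \<le> int n + 1.
        ((-1) powi q * sph_comp a (- q) * c * h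
          * complex_of_real (clebsch_gordan (int n) \<mu> 1 q (int j) (\<mu> + q))) *s vsh_Y j n (q + \<mu>) u)
    = (\<Sum>q=-1..1. (c * h * ((-1) powi q * sph_comp a (- q))) *s (\<Sum>j | \<bar>int n - 1\<bar> \<le> int j \<and> int j \<le> int n + 1.
        complex_of_real (clebsch_gordan (int n) \<mu> 1 q (int j) (\<mu> + q)) *s vsh_Y j n (\<mu> + q) u))"
    unfolding vec.scale_sum_right by (simp add: mult_ac add.commute)
  also have "\<dots> = (\<Sum>q=-1..1. (c * h * sph_harm n \<mu> u) *s (((-1) powi q * sph_comp a (- q)) *s sph_basis q))"
  proof (intro sum.cong refl, goal_cases)
    case (1 q)
    then have "\<bar>q\<bar> \<le> 1" by auto
    from sph_harm_smult_basis[OF u \<mu> this] show ?case by (simp only: vector_smult_assoc mult_ac)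
  qed
  finally show ?thesis unfolding vec.scale_sum_right [symmetric] sph_comp_cvec .
qed

section \<open>Addition theorem for the potential and its gradient\<close>

text \<open>The ratio between the potential \<open>Y / |x| ^ (l + 1)\<close> and \<open>irreg_at\<close>.\<close>
definition multipole_factor :: "nat \<Rightarrow> int \<Rightarrow> real" where
  "multipole_factor l m = sqrt ((2 * real l + 1) / (4 * pi)) / sqrt (solid_norm2 l m)"

lemma multipole_factor_norm2: "multipole_factor l m * solid_norm2 l m = sph_norm l m"
proof -
  have "solid_norm2 l m = sqrt (solid_norm2 l m) * sqrt (solid_norm2 l m)" by simp
  then show ?thesis
    unfolding multipole_factor_def sph_norm_def real_sqrt_mult
    by (metis nonzero_eq_divide_eq mult.assoc real_sqrt_eq_zero_cancel_iff solid_norm2_pos(2) times_divide_eq_left)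
qed

lemma irreg_at_eq:
  "irreg_at l m x = of_real (solid_norm2 l m) * solid_at l m x / of_real (norm x ^ (2 * l + 1))"
  by (simp add: irreg_at_def irreg_def solid_at_def power_divide)

lemma irreg_solid_eq:
  assumes "x \<noteq> 0"
  shows "irreg_solid l m x = irreg_at l m x / of_real (sqrt (solid_norm2 l m))"
proof -
  have e: "sqrt (4 * pi / (2 * real l + 1)) * sph_norm l m = solid_norm2 l m / sqrt (solid_norm2 l m)"
    by (simp add: sph_norm_def real_sqrt_mult real_sqrt_divide real_div_sqrt add_nonneg_eq_0_iff)
  have "irreg_solid l m x = of_real (sqrt (4 * pi / (2 * real l + 1)) * sph_norm l m)
      * solid_at l m x / of_real (norm x ^ (l + 1) * norm x ^ l)"
    unfolding irreg_solid_def sph_harm_sgn[OF assms] by simp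
  also have "norm x ^ (l + 1) * norm x ^ l = norm x ^ (2 * l + 1)"
    by (simp add: mult_2 flip: power_add)
  finally show ?thesis unfolding e irreg_at_eq by (simp add: mult_ac)
qed

lemma binomial_product:
  assumes "\<bar>m\<bar> \<le> int l" "\<bar>\<mu>\<bar> \<le> int n"
  shows "real (nat (int l + int n + \<mu> - m) choose nat (int n + \<mu>))
        * real (nat (int l + int n + m - \<mu>) choose nat (int n - \<mu>))
     = solid_norm2 (l + n) (m - \<mu>) / (solid_norm2 n \<mu> * solid_norm2 l m)"
proof -
  have 1: "real (nat (int l + int n + \<mu> - m) choose nat (int n + \<mu>))
      = fact (nat (int l + int n + \<mu> - m)) / (fact (nat (int n + \<mu>)) * fact (nat (int l - m)))"
  proof -
    have "nat (int l + int n + \<mu> - m) - nat (int n + \<mu>) = nat (int l - m)" "nat (int n + \<mu>) \<le> nat (int l + int n + \<mu> - m)"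
      using assms by auto
    then show ?thesis by (simp add: binomial_fact)
  qed
  have 2: "real (nat (int l + int n + m - \<mu>) choose nat (int n - \<mu>))
      = fact (nat (int l + int n + m - \<mu>)) / (fact (nat (int n - \<mu>)) * fact (nat (int l + m)))"
  proof -
    have "nat (int l + int n + m - \<mu>) - nat (int n - \<mu>) = nat (int l + m)" "nat (int n - \<mu>) \<le> nat (int l + int n + m - \<mu>)"
      using assms by auto
    then show ?thesis by (simp add: binomial_fact)
  qed
  have e: "int (l + n) - (m - \<mu>) = int l + int n + \<mu> - m" "int (l + n) + (m - \<mu>) = int l + int n + m - \<mu>"
    by simp_all
  show ?thesis unfolding 1 2 solid_norm2_def e by (simp add: mult_ac)
qed

text \<open>
  The binomial coefficients in \<open>H\<close> convert between the normalisations; without them the coefficient is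
  the one of \<open>irreg_addition\<close>.
\<close>
lemma H_coeff_eq:
  assumes "\<bar>m\<bar> \<le> int l" "\<bar>\<mu>\<bar> \<le> int n" "a \<noteq> 0"
  shows "H_coeff l n m \<mu> a * of_real (sph_norm n \<mu>)
     = of_real (multipole_factor l m) * ((-1) powi (int n + \<mu>) * irreg_at (l + n) (m - \<mu>) a)"
proof -
  define N where "N = sqrt (solid_norm2 (l + n) (m - \<mu>))"
  have N: "N \<noteq> 0" by (simp add: N_def)
  have p: "2 * real n + 1 > 0" by simp
  have "sqrt ((2 * real l + 1) / (2 * real n + 1)) * sqrt (solid_norm2 (l + n) (m - \<mu>) / (solid_norm2 n \<mu> * solid_norm2 l m))
     * sph_norm n \<mu> = N * multipole_factor l m"
    using p by (simp add: multipole_factor_def sph_norm_def real_sqrt_mult real_sqrt_divide N_def mult_ac)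
  then have "complex_of_real (sqrt ((2 * real l + 1) / (2 * real n + 1))
      * sqrt (solid_norm2 (l + n) (m - \<mu>) / (solid_norm2 n \<mu> * solid_norm2 l m)) * sph_norm n \<mu>)
     = of_real N * of_real (multipole_factor l m)" by simp
  moreover have "H_coeff l n m \<mu> a * of_real (sph_norm n \<mu>) = (-1) powi (int n + \<mu>) * irreg_at (l + n) (m - \<mu>) a / of_real N
      * complex_of_real (sqrt ((2 * real l + 1) / (2 * real n + 1))
      * sqrt (solid_norm2 (l + n) (m - \<mu>) / (solid_norm2 n \<mu> * solid_norm2 l m)) * sph_norm n \<mu>)"
    unfolding H_coeff_def binomial_product[OF assms(1,2)] irreg_solid_eq[OF assms(3)] N_def by simp
  ultimately show ?thesis using N by simp
qed

definition potential :: "nat \<Rightarrow> int \<Rightarrow> real ^ 3 \<Rightarrow> complex" where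
  "potential l m x = sph_harm l m (sgn x) / of_real (norm x ^ (l + 1))"

text \<open>The gradient of the potential.\<close>
definition potential_grad :: "nat \<Rightarrow> int \<Rightarrow> real ^ 3 \<Rightarrow> complex ^ 3" where
  "potential_grad l m x = (1 / of_real (norm x ^ (l + 2))) *s vsh_V l (sph_harm l m) (sgn x)"

lemma potential_eq:
  assumes "x \<noteq> 0"
  shows "potential l m x = of_real (multipole_factor l m) * irreg_at l m x"
proof -
  have "norm x ^ (2 * l + 1) = norm x ^ l * norm x ^ (l + 1)"
    by (simp add: mult_2 power_add)
  note e = this
  show ?thesis
    unfolding potential_def sph_harm_sgn[OF assms] irreg_at_eq multipole_factor_norm2[symmetric] e
    by (simp add: mult_ac)
qed

text \<open>
  The polynomial factors in \<open>vsh_V_eq\<close> are the quotients of neighbouring \<open>solid_norm2\<close>, so that every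
  component is itself an irregular harmonic.
\<close>
lemma potential_grad_eq:
  assumes x: "x \<noteq> 0" and m: "\<bar>m\<bar> \<le> int l"
  shows "potential_grad l m x = of_real (multipole_factor l m) *s
    sph_vec (- irreg_at (Suc l) m x) (irreg_at (Suc l) (m - 1) x / sqrt 2) (irreg_at (Suc l) (m + 1) x / sqrt 2)"
proof -
  have n: "norm (sgn x) = 1" using x by (simp add: norm_sgn)
  have xs: "x = norm x *\<^sub>R sgn x" using x by (simp add: sgn_div_norm)
  have s: "solid_at (Suc l) \<mu> x = of_real (norm x) ^ Suc l * solid_at (Suc l) \<mu> (sgn x)" for \<mu>
    by (metis xs solid_at_scaleR)
  have "norm x ^ (2 * Suc l + 1) = norm x ^ (l + 2) * norm x ^ Suc l"
    by (simp add: mult_2 power_add)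
  then have i: "irreg_at (Suc l) \<mu> x = of_real (solid_norm2 (Suc l) \<mu>) * solid_at (Suc l) \<mu> (sgn x) / of_real (norm x ^ (l + 2))" for \<mu>
    unfolding irreg_at_eq s using x by simp
  show ?thesis
    unfolding potential_grad_def vsh_V_eq[OF n] i solid_norm2_Suc[OF m] sph_vec_linear
      multipole_factor_norm2[symmetric]
    by (rule arg_cong3[where f = sph_vec]) simp_all
qed

lemma sums_vec: "(\<And>i. (\<lambda>n. f n $ i) sums (s $ i)) \<Longrightarrow> f sums (s :: complex ^ 3)"
  unfolding sums_def by (rule vec_tendstoI) simp

lemma sums_vec_nth: "f sums s \<Longrightarrow> (\<lambda>n. f n $ i) sums ((s :: complex ^ 3) $ i)"
  unfolding sums_def by (drule tendsto_vec_nth) simp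

lemma sums_smult: "f sums s \<Longrightarrow> (\<lambda>n. c *s f n) sums (c *s (s :: complex ^ 3))"
  by (rule sums_vec) (simp add: sums_mult sums_vec_nth)

lemma sums_smult2: "f sums s \<Longrightarrow> (\<lambda>n. f n *s v) sums (s *s (v :: complex ^ 3))"
  by (rule sums_vec) (simp add: sums_mult2)

lemma sums_sph_vec:
  assumes "f sums a" "g sums b" "h sums c"
  shows "(\<lambda>n. sph_vec (f n) (g n) (h n)) sums sph_vec a b c"
proof (rule sums_vec)
  fix i :: 3
  show "(\<lambda>n. sph_vec (f n) (g n) (h n) $ i) sums (sph_vec a b c $ i)"
    using exhaust_3[of i] by (auto intro!: sums_divide sums_diff sums_mult sums_add sums_minus assms)
qed

lemma sph_vec_sum: "(\<Sum>x\<in>A. sph_vec (f x) (g x) (h x)) = sph_vec (sum f A) (sum g A) (sum h A)"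
proof -
  have "sph_vec 0 0 0 = 0" by (simp add: vec_eq_iff forall_3)
  then show ?thesis
    by (induction A rule: infinite_finite_induct) (simp_all add: sph_vec_linear)
qed

lemma pow_sph_harm_sgn:
  assumes "r \<noteq> 0"
  shows "of_real (norm r ^ n) * sph_harm n \<mu> (sgn r) = of_real (sph_norm n \<mu>) * solid_at n \<mu> r"
  using assms by (simp add: sph_harm_sgn)

theorem potential_addition:
  assumes ra: "norm r < norm a" and r: "norm r > 0" and m: "\<bar>m\<bar> \<le> int l"
  shows "(\<lambda>n. \<Sum>\<mu>=-int n..int n. H_coeff l n m \<mu> a * (of_real (norm r ^ n) * sph_harm n \<mu> (sgn r)))
     sums potential l m (r + a)"
proof -
  have nz: "r \<noteq> 0" "a \<noteq> 0" "r + a \<noteq> 0"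
    using ra r by (auto simp: add_eq_0_iff)
  have "(\<lambda>n. of_real (multipole_factor l m) *
      (\<Sum>\<mu>=-int n..int n. ((-1) powi (int n + \<mu>) * irreg_at (l + n) (m - \<mu>) a) * solid_at n \<mu> r))
     sums potential l m (r + a)"
    unfolding potential_eq[OF nz(3)] using irreg_addition[OF ra r m] by (intro sums_mult) (simp add: add.commute)
  also have "(\<lambda>n. of_real (multipole_factor l m) *
      (\<Sum>\<mu>=-int n..int n. ((-1) powi (int n + \<mu>) * irreg_at (l + n) (m - \<mu>) a) * solid_at n \<mu> r))
    = (\<lambda>n. \<Sum>\<mu>=-int n..int n. H_coeff l n m \<mu> a * (of_real (norm r ^ n) * sph_harm n \<mu> (sgn r)))"
  proof (rule ext, unfold sum_distrib_left, intro sum.cong refl, goal_cases)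
    case (1 n \<mu>)
    then have "\<bar>\<mu>\<bar> \<le> int n" by auto
    from H_coeff_eq[OF m this nz(2)] show ?case
      unfolding pow_sph_harm_sgn[OF nz(1)] by (simp flip: mult.assoc)
  qed
  finally show ?thesis .
qed

text \<open>
  A component of the gradient of a solid harmonic of degree \<open>n + 1\<close> has degree \<open>n\<close> and order shifted by
  \<open>c\<close>. Reindexing the sum moves both shifts to the irregular harmonic.
\<close>
lemma sum_solid_shift_sign:
  assumes c: "\<bar>c\<bar> \<le> 1"
  shows "(\<Sum>\<mu>=-int (Suc n)..int (Suc n). ((-1) powi (int (Suc n) + \<mu>) * irreg_at (l + Suc n) (m - \<mu>) a) * solid_at n (\<mu> + c) r)
    = (-1) powi (1 - c) * (\<Sum>\<mu>=-int n..int n. ((-1) powi (int n + \<mu>) * irreg_at (Suc l + n) (m + c - \<mu>) a) * solid_at n \<mu> r)"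
proof -
  have "(\<Sum>\<mu>=-int n..int n. ((-1) powi (int (Suc n) + (\<mu> - c)) * irreg_at (l + Suc n) (m - (\<mu> - c)) a) * solid_at n \<mu> r)
     = (\<Sum>\<mu>=-int (Suc n)..int (Suc n). ((-1) powi (int (Suc n) + (\<mu> + c - c)) * irreg_at (l + Suc n) (m - (\<mu> + c - c)) a) * solid_at n (\<mu> + c) r)"
    unfolding solid_at_def by (rule sum_solid_shift[OF c])
  moreover have "(-1 :: complex) powi (int (Suc n) + (\<mu> - c)) = (-1) powi (1 - c) * (-1) powi (int n + \<mu>)" for \<mu>
    by (simp add: algebra_simps flip: power_int_add)
  ultimately show ?thesis
    by (simp add: sum_distrib_left algebra_simps)
qed

lemma solid_grad_Suc:
  "solid_grad (Suc n) \<mu> x = sph_vec (solid_at n \<mu> x) (solid_at n (\<mu> - 1) x / sqrt 2) (solid_at n (\<mu> + 1) x / sqrt 2)"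
  by (simp add: solid_grad_def solid_at_def)

text \<open>
  The three spherical components are the addition theorems for the irregular harmonics of degree
  \<open>l + 1\<close> and order \<open>m\<close>, \<open>m - 1\<close> and \<open>m + 1\<close>.
\<close>
theorem potential_grad_addition:
  assumes ra: "norm r < norm a" and r: "norm r > 0" and m: "\<bar>m\<bar> \<le> int l"
  shows "(\<lambda>n. \<Sum>\<mu>=-int (Suc n)..int (Suc n).
       (H_coeff l (Suc n) m \<mu> a * of_real (norm r ^ n)) *s vsh_W (Suc n) (sph_harm (Suc n) \<mu>) (sgn r))
     sums potential_grad l m (r + a)"
proof -
  have nz: "r \<noteq> 0" "a \<noteq> 0" "r + a \<noteq> 0"
    using ra r by (auto simp: add_eq_0_iff)
  have u: "norm (sgn r) = 1" using nz by (simp add: norm_sgn)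
  define T where "T M n = (\<Sum>\<mu>=-int n..int n. ((-1) powi (int n + \<mu>) * irreg_at (Suc l + n) (M - \<mu>) a) * solid_at n \<mu> r)" for M n
  have T: "T M sums irreg_at (Suc l) M (r + a)" if "\<bar>M\<bar> \<le> int (Suc l)" for M
    unfolding T_def using irreg_addition[OF ra r that] by (simp add: add.commute)
  have "(\<lambda>n. of_real (multipole_factor l m) *s sph_vec (- T m n) (T (m - 1) n / sqrt 2) (T (m + 1) n / sqrt 2))
     sums potential_grad l m (r + a)"
    unfolding potential_grad_eq[OF nz(3) m]
    by (intro sums_smult sums_sph_vec sums_minus sums_divide T) (use m in auto)
  also have "(\<lambda>n. of_real (multipole_factor l m) *s sph_vec (- T m n) (T (m - 1) n / sqrt 2) (T (m + 1) n / sqrt 2))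
    = (\<lambda>n. \<Sum>\<mu>=-int (Suc n)..int (Suc n).
       (H_coeff l (Suc n) m \<mu> a * of_real (norm r ^ n)) *s vsh_W (Suc n) (sph_harm (Suc n) \<mu>) (sgn r))"
  proof
    fix n
    define s where "s \<mu> = (-1) powi (int (Suc n) + \<mu>) * irreg_at (l + Suc n) (m - \<mu>) a" for \<mu>
    have rs: "r = norm r *\<^sub>R sgn r" using nz by (simp add: sgn_div_norm)
    have sr: "solid_at n \<mu> r = of_real (norm r ^ n) * solid_at n \<mu> (sgn r)" for \<mu>
      by (metis rs solid_at_scaleR of_real_power)
    have "(\<Sum>\<mu>=-int (Suc n)..int (Suc n).
       (H_coeff l (Suc n) m \<mu> a * of_real (norm r ^ n)) *s vsh_W (Suc n) (sph_harm (Suc n) \<mu>) (sgn r))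
      = (\<Sum>\<mu>=-int (Suc n)..int (Suc n). of_real (multipole_factor l m) *s (s \<mu> *s
          sph_vec (solid_at n \<mu> r) (solid_at n (\<mu> - 1) r / sqrt 2) (solid_at n (\<mu> + 1) r / sqrt 2)))"
    proof (intro sum.cong refl, goal_cases)
      case (1 \<mu>)
      then have "\<bar>\<mu>\<bar> \<le> int (Suc n)" by auto
      note h = H_coeff_eq[OF m this nz(2), folded s_def]
      have "(H_coeff l (Suc n) m \<mu> a * of_real (norm r ^ n)) *s vsh_W (Suc n) (sph_harm (Suc n) \<mu>) (sgn r)
         = (H_coeff l (Suc n) m \<mu> a * of_real (sph_norm (Suc n) \<mu>)) *s (of_real (norm r ^ n) *s solid_grad (Suc n) \<mu> (sgn r))"
        unfolding vsh_W_eq[OF u] by (simp only: vector_smult_assoc mult_ac)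
      then show ?case
        unfolding h solid_grad_Suc sph_vec_linear sr by (simp add: mult_ac)
    qed
    also have "\<dots> = of_real (multipole_factor l m) *s sph_vec
       (\<Sum>\<mu>=-int (Suc n)..int (Suc n). s \<mu> * solid_at n (\<mu> + 0) r)
       ((\<Sum>\<mu>=-int (Suc n)..int (Suc n). s \<mu> * solid_at n (\<mu> + (-1)) r) / sqrt 2)
       ((\<Sum>\<mu>=-int (Suc n)..int (Suc n). s \<mu> * solid_at n (\<mu> + 1) r) / sqrt 2)"
      unfolding vec.scale_sum_right [symmetric] sph_vec_linear sph_vec_sum by (simp add: sum_divide_distrib sum_distrib_left)
    also have "\<dots> = of_real (multipole_factor l m) *s sph_vec (- T m n) (T (m - 1) n / sqrt 2) (T (m + 1) n / sqrt 2)"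
      unfolding s_def by (subst (1 2 3) sum_solid_shift_sign) (simp_all add: T_def)
    finally show "of_real (multipole_factor l m) *s sph_vec (- T m n) (T (m - 1) n / sqrt 2) (T (m + 1) n / sqrt 2)
      = (\<Sum>\<mu>=-int (Suc n)..int (Suc n).
       (H_coeff l (Suc n) m \<mu> a * of_real (norm r ^ n)) *s vsh_W (Suc n) (sph_harm (Suc n) \<mu>) (sgn r))" ..
  qed
  finally show ?thesis .
qed

text \<open>
  This expresses \<open>W\<close> by quantities that have addition theorems; it rests on
  \<open>W = V + (2 l + 1) Y x / |x|\<close>.
\<close>
lemma vsh_W_from_potential:
  assumes "x \<noteq> 0"
  shows "of_real (norm x powi (- int l)) *s vsh_W l (sph_harm l m) (sgn x)
     = of_real ((norm x)\<^sup>2) *s potential_grad l m x + (of_nat (2 * l + 1) * potential l m x) *s cvec x"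
proof -
  have x: "cvec x = of_real (norm x) *s cvec (sgn x)"
    using assms by (simp add: vec_eq_iff sgn_div_norm)
  have W: "vsh_W l (sph_harm l m) (sgn x)
     = vsh_V l (sph_harm l m) (sgn x) + (of_nat (2 * l + 1) * sph_harm l m (sgn x)) *s cvec (sgn x)"
    by (simp add: vsh_W_def vsh_V_def vec_eq_iff algebra_simps)
  show ?thesis
    unfolding x W potential_def potential_grad_def using assms
    by (simp add: vec_eq_iff power_int_minus power_add power2_eq_square field_simps)
qed

section \<open>Addition theorem for the vector spherical harmonics\<close>

lemma real_order_sum_smult:
  "(\<Sum>\<mu>\<in>A. (H_coeff_real l n m \<mu> a * g \<mu>) *s (v \<mu> :: complex ^ 3))
    = fst (real_order_coeff m) *s (\<Sum>\<mu>\<in>A. (H_coeff l n m \<mu> a * g \<mu>) *s v \<mu>)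
    + snd (real_order_coeff m) *s (\<Sum>\<mu>\<in>A. (H_coeff l n (- m) \<mu> a * g \<mu>) *s v \<mu>)"
  by (simp add: H_coeff_real_def real_order_linear vec.scale_sum_right vec.scale_left_distrib distrib_right
      mult.assoc flip: sum.distrib)

lemma real_order_sum_mult:
  "(\<Sum>\<mu>\<in>A. H_coeff_real l n m \<mu> a * g \<mu>)
    = fst (real_order_coeff m) * (\<Sum>\<mu>\<in>A. H_coeff l n m \<mu> a * g \<mu>)
    + snd (real_order_coeff m) * (\<Sum>\<mu>\<in>A. H_coeff l n (- m) \<mu> a * g \<mu>)"
  by (simp add: H_coeff_real_def real_order_linear sum_distrib_left distrib_right
      mult.assoc flip: sum.distrib)

lemma partial_sums_smult_from_0:
  fixes f :: "nat \<Rightarrow> complex ^ 3"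
  assumes "\<And>n. f n = g n *s v" "g sums s"
  shows "(\<lambda>N. \<Sum>n=0..N. f n) \<longlonglongrightarrow> s *s v"
  using sums_smult2[OF assms(2), of v] by (simp add: sums_def' assms(1))

lemma partial_sums_smult_from_1:
  fixes f :: "nat \<Rightarrow> complex ^ 3"
  assumes "\<And>n. n > 0 \<Longrightarrow> f n = c *s g n" "(\<lambda>n. g (Suc n)) sums s"
  shows "(\<lambda>N. \<Sum>n=1..N. f n) \<longlonglongrightarrow> c *s s"
  using sums_smult[OF assms(2), of c] by (simp add: sums_def sum.atLeast1_atMost_eq assms(1))

lemma cvec_add: "cvec (x + y) = cvec x + cvec y"
  by (simp add: vec_eq_iff)

theorem theorem3p7:
  fixes r a r' :: "real ^ 3" and l :: nat and m :: int
  assumes "norm a > norm r" and "norm r > 0"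
    and "r' = r + a"
    and "\<bar>m\<bar> \<le> int l"
  shows "(\<exists>S1 S2 S3 S4 :: complex ^ 3.
     (\<lambda>N. \<Sum>n=1..N. \<Sum>\<mu>=-int n..int n.
        (H_coeff_real l n m \<mu> a
          * complex_of_real (norm r ^ (n + 1) + (norm a)\<^sup>2 * norm r ^ (n - 1)))
        *s vsh_W n (sph_harm n \<mu>) (sgn r)) \<longlonglongrightarrow> S1
   \<and> (\<lambda>N. \<Sum>n=1..N. \<Sum>\<mu>=-int n..int n. \<Sum>q=-1..1. \<Sum>m1=-1..1.
        \<Sum>k | \<bar>int n - 2\<bar> \<le> int k \<and> int k \<le> int n \<and> int k \<noteq> int n - 1.
        \<Sum>j | \<bar>int k - 1\<bar> \<le> int j \<and> int j \<le> int k + 1.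
        (complex_of_real (2 * norm r ^ n) * sph_comp a (- q) * H_coeff_real l n m \<mu> a
          * complex_of_real (K_coeff k j n m1 \<mu> q))
        *s vsh_Y j k (q + \<mu>) (sgn r)) \<longlonglongrightarrow> S2
   \<and> (\<lambda>N. \<Sum>n=0..N. \<Sum>\<mu>=-int n..int n.
        (complex_of_real (norm r ^ (n + 1) / (2 * real n + 1)) * H_coeff_real l n m \<mu> a)
        *s (vsh_W n (sph_harm n \<mu>) (sgn r) - vsh_V n (sph_harm n \<mu>) (sgn r))) \<longlonglongrightarrow> S3
   \<and> (\<lambda>N. \<Sum>n=0..N. \<Sum>\<mu>=-int n..int n. \<Sum>q=-1..1.
        \<Sum>j | \<bar>int n - 1\<bar> \<le> int j \<and> int j \<le> int n + 1.
        ((-1) powi q * sph_comp a (- q) * complex_of_real (norm r ^ n) * H_coeff_real l n m \<mu> a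
          * complex_of_real (clebsch_gordan (int n) \<mu> 1 q (int j) (\<mu> + q)))
        *s vsh_Y j n (q + \<mu>) (sgn r)) \<longlonglongrightarrow> S4
   \<and> complex_of_real (norm r' powi (- int l)) *s vsh_W l (real_sph_harm l m) (sgn r')
       = S1 + S2 + of_nat (2 * l + 1) *s S3 + of_nat (2 * l + 1) *s S4)
   \<and> (\<forall>Z \<in> {vsh_V, vsh_W, vsh_X}. \<forall>(n::nat) (\<mu>::int) (u::real ^ 3). \<bar>\<mu>\<bar> \<le> int n \<longrightarrow> norm u = 1 \<longrightarrow>
        Z n (sph_harm n \<mu>) u =
          (if \<mu> > 0 then
             ((-1) powi \<mu> / complex_of_real (sqrt 2))
             *s (Z n (real_sph_harm n \<mu>) u + \<i> *s Z n (real_sph_harm n (- \<mu>)) u)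
           else if \<mu> = 0 then Z n (real_sph_harm n 0) u
           else
             (1 / complex_of_real (sqrt 2))
             *s (Z n (real_sph_harm n (- \<mu>)) u - \<i> *s Z n (real_sph_harm n \<mu>) u)))"
proof (intro conjI ballI allI impI vsh_complex_from_real)
  have nz: "r \<noteq> 0" "r' \<noteq> 0"
    using assms(1-3) by (auto simp: add_eq_0_iff)
  have u: "norm (sgn r) = 1" using nz by (simp add: norm_sgn)
  have u': "norm (sgn r') = 1" using nz by (simp add: norm_sgn)
  have m': "\<bar>- m\<bar> \<le> int l" using assms(4) by simp
  define \<alpha> \<beta> where "\<alpha> = fst (real_order_coeff m)" and "\<beta> = snd (real_order_coeff m)"
  define h where "h n \<mu> = H_coeff_real l n m \<mu> a" for n \<mu>
  define T where "T n = (\<Sum>\<mu>=-int n..int n. h n \<mu> * (of_real (norm r ^ n) * sph_harm n \<mu> (sgn r)))" for n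
  define G where "G n = (\<Sum>\<mu>=-int n..int n. (h n \<mu> * of_real (norm r ^ (n - 1))) *s vsh_W n (sph_harm n \<mu>) (sgn r))" for n
  define P where "P = \<alpha> * potential l m r' + \<beta> * potential l (- m) r'"
  define D where "D = \<alpha> *s potential_grad l m r' + \<beta> *s potential_grad l (- m) r'"
  have T: "T sums P"
    unfolding T_def h_def real_order_sum_mult P_def \<alpha>_def \<beta>_def assms(3)
    by (intro sums_add sums_mult potential_addition assms m')
  have G: "(\<lambda>n. G (Suc n)) sums D"
    unfolding G_def h_def real_order_sum_smult D_def \<alpha>_def \<beta>_def assms(3) diff_Suc_1
    by (intro sums_add sums_smult potential_grad_addition assms m')
  have rs: "cvec r = of_real (norm r) *s cvec (sgn r)"
    using nz by (simp add: vec_eq_iff sgn_div_norm)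
  \<comment> \<open>In each degree, the summands of the four series are multiples of \<open>G n\<close> or of \<open>T n\<close>.\<close>
  have t1: "(\<Sum>\<mu>=-int n..int n. (h n \<mu> * complex_of_real (norm r ^ (n + 1) + (norm a)\<^sup>2 * norm r ^ (n - 1)))
        *s vsh_W n (sph_harm n \<mu>) (sgn r)) = of_real ((norm r)\<^sup>2 + (norm a)\<^sup>2) *s G n" if "n > 0" for n
  proof -
    have "norm r ^ (n + 1) + (norm a)\<^sup>2 * norm r ^ (n - 1) = ((norm r)\<^sup>2 + (norm a)\<^sup>2) * norm r ^ (n - 1)"
      using that by (cases n) (simp_all add: algebra_simps power2_eq_square)
    then show ?thesis unfolding G_def vec.scale_sum_right by (simp add: mult_ac)
  qed
  have t2: "(\<Sum>\<mu>=-int n..int n. \<Sum>q=-1..1. \<Sum>m1=-1..1.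
        \<Sum>k | \<bar>int n - 2\<bar> \<le> int k \<and> int k \<le> int n \<and> int k \<noteq> int n - 1.
        \<Sum>j | \<bar>int k - 1\<bar> \<le> int j \<and> int j \<le> int k + 1.
        (complex_of_real (2 * norm r ^ n) * sph_comp a (- q) * h n \<mu>
          * complex_of_real (K_coeff k j n m1 \<mu> q)) *s vsh_Y j k (q + \<mu>) (sgn r))
      = of_real (2 * (a \<bullet> r)) *s G n" if n: "n > 0" for n
  proof -
    have e: "2 * norm r ^ n * (a \<bullet> sgn r) = 2 * (a \<bullet> r) * norm r ^ (n - 1)"
      using n nz by (cases n) (simp_all add: sgn_div_norm)
    show ?thesis unfolding G_def vec.scale_sum_right
    proof (intro sum.cong refl, goal_cases)
      case (1 \<mu>)
      then have "\<bar>\<mu>\<bar> \<le> int n" by auto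
      have "complex_of_real (2 * norm r ^ n) * h n \<mu> * of_real (a \<bullet> sgn r)
          = of_real (2 * (a \<bullet> r)) * (h n \<mu> * of_real (norm r ^ (n - 1)))"
        using arg_cong[OF e, of complex_of_real] by (simp add: mult_ac)
      then show ?case
        unfolding inner_mult_vsh_W[OF u \<open>\<bar>\<mu>\<bar> \<le> int n\<close> n] vector_smult_assoc by simp
    qed
  qed
  have t3: "(\<Sum>\<mu>=-int n..int n. (complex_of_real (norm r ^ (n + 1) / (2 * real n + 1)) * h n \<mu>)
        *s (vsh_W n (sph_harm n \<mu>) (sgn r) - vsh_V n (sph_harm n \<mu>) (sgn r))) = T n *s cvec r" for n
  proof -
    have "vsh_W n (sph_harm n \<mu>) (sgn r) - vsh_V n (sph_harm n \<mu>) (sgn r)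
        = (of_real (2 * real n + 1) * sph_harm n \<mu> (sgn r)) *s cvec (sgn r)" for \<mu>
      by (simp add: vsh_W_def vsh_V_def vec_eq_iff algebra_simps)
    moreover have "2 * real n + 1 \<noteq> 0" by simp
    then have e: "complex_of_real (norm r ^ (n + 1) / (2 * real n + 1)) * of_real (2 * real n + 1) = of_real (norm r ^ n) * of_real (norm r)"
      unfolding of_real_mult [symmetric] by simp
    have "complex_of_real (norm r ^ (n + 1) / (2 * real n + 1)) * h n \<mu> * (of_real (2 * real n + 1) * sph_harm n \<mu> (sgn r))
       = h n \<mu> * (of_real (norm r ^ n) * sph_harm n \<mu> (sgn r)) * of_real (norm r)" for \<mu>
      using arg_cong[OF e, of "\<lambda>x. x * (h n \<mu> * sph_harm n \<mu> (sgn r))"]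
      by (simp only: mult_ac)
    ultimately show ?thesis
      unfolding T_def vec.scale_sum_left rs by (simp only: vector_smult_assoc)
  qed
  have t4: "(\<Sum>\<mu>=-int n..int n. \<Sum>q=-1..1. \<Sum>j | \<bar>int n - 1\<bar> \<le> int j \<and> int j \<le> int n + 1.
        ((-1) powi q * sph_comp a (- q) * complex_of_real (norm r ^ n) * h n \<mu>
          * complex_of_real (clebsch_gordan (int n) \<mu> 1 q (int j) (\<mu> + q)))
        *s vsh_Y j n (q + \<mu>) (sgn r)) = T n *s cvec a" for n
    unfolding T_def vec.scale_sum_left
  proof (intro sum.cong refl, goal_cases)
    case (1 \<mu>)
    then have "\<bar>\<mu>\<bar> \<le> int n" by auto
    then show ?case
      by (subst vec_mult_sph_harm[OF u]) (simp_all only: mult_ac)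
  qed
  \<comment> \<open>The four limits add up because \<open>|r + a|\<^sup>2 = |r|\<^sup>2 + |a|\<^sup>2 + 2 (a \<bullet> r)\<close>.\<close>
  have fin: "complex_of_real (norm r' powi (- int l)) *s vsh_W l (real_sph_harm l m) (sgn r')
       = of_real ((norm r)\<^sup>2 + (norm a)\<^sup>2) *s D + of_real (2 * (a \<bullet> r)) *s D
         + of_nat (2 * l + 1) *s (P *s cvec r) + of_nat (2 * l + 1) *s (P *s cvec a)"
  proof -
    have "complex_of_real (norm r' powi (- int l)) *s vsh_W l (real_sph_harm l m) (sgn r')
      = \<alpha> *s (of_real (norm r' powi (- int l)) *s vsh_W l (sph_harm l m) (sgn r'))
      + \<beta> *s (of_real (norm r' powi (- int l)) *s vsh_W l (sph_harm l (- m)) (sgn r'))"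
      by (simp add: vsh_real_sph_harm[OF _ u'] \<alpha>_def \<beta>_def vec.scale_right_distrib mult.commute)
    also have "\<dots> = of_real ((norm r')\<^sup>2) *s D + of_nat (2 * l + 1) *s (P *s cvec r')"
      unfolding vsh_W_from_potential[OF nz(2)] D_def P_def by (simp add: vec_eq_iff algebra_simps)
    also have "(norm r')\<^sup>2 = (norm r)\<^sup>2 + (norm a)\<^sup>2 + 2 * (a \<bullet> r)"
      by (simp add: assms(3) power2_norm_eq_inner inner_add_left inner_add_right inner_commute)
    finally show ?thesis
      unfolding assms(3) cvec_add by (simp add: vec_eq_iff algebra_simps)
  qed
  show "\<exists>S1 S2 S3 S4 :: complex ^ 3. (\<lambda>N. \<Sum>n=1..N. \<Sum>\<mu>=-int n..int n.
        (H_coeff_real l n m \<mu> a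
          * complex_of_real (norm r ^ (n + 1) + (norm a)\<^sup>2 * norm r ^ (n - 1)))
        *s vsh_W n (sph_harm n \<mu>) (sgn r)) \<longlonglongrightarrow> S1
   \<and> (\<lambda>N. \<Sum>n=1..N. \<Sum>\<mu>=-int n..int n. \<Sum>q=-1..1. \<Sum>m1=-1..1.
        \<Sum>k | \<bar>int n - 2\<bar> \<le> int k \<and> int k \<le> int n \<and> int k \<noteq> int n - 1.
        \<Sum>j | \<bar>int k - 1\<bar> \<le> int j \<and> int j \<le> int k + 1.
        (complex_of_real (2 * norm r ^ n) * sph_comp a (- q) * H_coeff_real l n m \<mu> a
          * complex_of_real (K_coeff k j n m1 \<mu> q))
        *s vsh_Y j k (q + \<mu>) (sgn r)) \<longlonglongrightarrow> S2
   \<and> (\<lambda>N. \<Sum>n=0..N. \<Sum>\<mu>=-int n..int n.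
        (complex_of_real (norm r ^ (n + 1) / (2 * real n + 1)) * H_coeff_real l n m \<mu> a)
        *s (vsh_W n (sph_harm n \<mu>) (sgn r) - vsh_V n (sph_harm n \<mu>) (sgn r))) \<longlonglongrightarrow> S3
   \<and> (\<lambda>N. \<Sum>n=0..N. \<Sum>\<mu>=-int n..int n. \<Sum>q=-1..1.
        \<Sum>j | \<bar>int n - 1\<bar> \<le> int j \<and> int j \<le> int n + 1.
        ((-1) powi q * sph_comp a (- q) * complex_of_real (norm r ^ n) * H_coeff_real l n m \<mu> a
          * complex_of_real (clebsch_gordan (int n) \<mu> 1 q (int j) (\<mu> + q)))
        *s vsh_Y j n (q + \<mu>) (sgn r)) \<longlonglongrightarrow> S4
   \<and> complex_of_real (norm r' powi (- int l)) *s vsh_W l (real_sph_harm l m) (sgn r')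
       = S1 + S2 + of_nat (2 * l + 1) *s S3 + of_nat (2 * l + 1) *s S4"
    unfolding h_def [symmetric]
    by (intro exI conjI, rule partial_sums_smult_from_1[OF t1 G], simp,
        rule partial_sums_smult_from_1[OF t2 G], simp,
        rule partial_sums_smult_from_0[OF t3 T], rule partial_sums_smult_from_0[OF t4 T], rule fin)
qed

end
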